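(* Let $\Gamma=(X,\mathcal E)$ be the complete bipartite graph $K_{3,3}$ (the distance-regular graph with $6$ vertices and intersection array $\{3,2;1,3\}$); the spectrum of its adjacency matrix $A$ is $3^10^4(-3)^1$. Let $x\in X$, $T=T(x)$, and fix any ordering of the three vertices of $\Gamma_1(x)$ and of the two vertices of $\Gamma_2(x)$. Then the standard module $V=\mathbb C^X$ is an orthogonal direct sum of irreducible $T$-modules $V=W_0\oplus W_{1,a}\oplus W_{1,b}\oplus W_2$, where two summands are isomorphic if and only if they have the same type in the following list, and the data are as listed. Each listed basis is a pure basis of the module. For each summand other than $W_0$, the seed vector $\nu$ spans $E_r^*W$ (so $\dim E_r^*W=1$), where $r$ is the endpoint of the summand $W$, and is given by its essential part. Type I ($W_0$): endpoint 0, multiplicity 1, dimension 3, diameter 2, shape $(1,1,1)$; basis $e_0^*,e_1^*,e_2^*$; matrix representing $A$: $\begin{pmatrix}0&3&0\\1&0&2\\0&3&0\end{pmatrix}$, with eigenvalues $3,0,-3$. Type II ($W_{1,a},W_{1,b}$): endpoint 1, multiplicity 2, dimension 1, diameter 0, shape $(1)$; basis $\nu$, where $\nu=[1,-1,0]$ for $W_{1,a}$ and $\nu=[1,1,-2]$ for $W_{1,b}$; matrix representing $A$: $\begin{pmatrix}0\end{pmatrix}$, with eigenvalue $0$. Type III ($W_2$): endpoint 2, multiplicity 1, dimension 1, diameter 0, shape $(1)$; basis $\nu$, where $\nu=[1,-1]$; matrix representing $A$: $\begin{pmatrix}0\end{pmatrix}$. Moreover $\dim T=3^2+1^2+1^2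=11$.
   Context: Let $\Gamma=(X,\mathcal E)$ be a finite undirected connected graph without loops or multiple edges, with path-length distance $d$ and diameter $D\ge1$; put $\Gamma_i(x)=\{y\in X:d(x,y)=i\}$. $\Gamma$ is distance-regular if for all $0\le h,i,j\le D$ the number $p^h_{i,j}=|\Gamma_i(y)\cap\Gamma_j(z)|$ is the same for all $y,z\in X$ with $d(y,z)=h$. Its intersection array is $\{b_0,\dots,b_{D-1};c_1,\dots,c_D\}$ with $b_i=p^i_{1,i+1}$, $c_i=p^i_{1,i-1}$. $A\in\mathrm{Mat}_X(\mathbb C)$ is the adjacency matrix; in its spectrum, exponents denote multiplicities. The standard module $V=\mathbb C^X$ (column vectors) carries the Hermitian inner product $\langle u,v\rangle=u^t\bar v$. Fix a base vertex $x\in X$. For $0\le i\le D$, $E_i^*=E_i^*(x)$ is the diagonal matrix with $(y,y)$-entry $1$ if $d(x,y)=i$ and $0$ otherwise, and $e_i^*\in V$ is the vector with $y$-entry $1$ if $d(x,y)=i$ and $0$ otherwise. The Terwilliger algebra $T=T(x)$ is the subalgebra of $\mathrm{Mat}_X(\mathbb C)$ generated by $A$ and $E_0^*,\dots,E_D^*$. A $T$-module is a subspace $W\subseteq V$ with $BW\subseteq W$ for all $B\in T$; it is irreducible if $W\ne0$ and it properly contains no nonzero $T$-module. Isomorphisms of $T$-modules are vector space isomorphisms commuting with every $B\in T$. The endpoint of $W$ is $r=\min\{i:E_i^*W\ne0\}$; the diameter of an irreducible $W$ is $\delta=|\{i:E_i^*W\ne0\}|-1$, and its shape is $(\dim E_r^*W,\dots,\dim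 E_{r+\delta}^*W)$. The multiplicity of an irreducible module is the number of summands isomorphic to it in an orthogonal decomposition of $V$ into irreducible $T$-modules. A nonzero vector is pure with support $i$ if it lies in $E_i^*V$; its essential part is the row vector of its coordinates at the vertices of $\Gamma_i(x)$ (all its other coordinates are $0$). A pure basis of an irreducible $T$-module is an ordered basis of pure vectors with weakly increasing supports. The matrix $B$ representing $A$ with respect to a basis $v_1,\dots,v_\ell$ is given by $Av_j=\sum_iB_{ij}v_i$. *)

theory Defs
  imports "Jordan_Normal_Form.Char_Poly" "HOL-Analysis.Analysis"
begin

no_notation Matrix.vec_index (infixl \<open>$\<close> 100)

section \<open>Distance-regular graphs\<close>

text \<open>A finite undirected graph without loops or multiple edges is given by its symmetric and
  irreflexive adjacency relation \<open>E\<close>; its vertex set \<open>X\<close> is the whole finite type \<open>'v\<close>.\<close>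

definition connected_simple_graph :: "'v::finite rel \<Rightarrow> bool" where
  "connected_simple_graph E \<longleftrightarrow> sym E \<and> irrefl E \<and> E\<^sup>* = UNIV"

definition complete_bipartite :: "nat \<Rightarrow> nat \<Rightarrow> 'v::finite rel \<Rightarrow> bool" where
  "complete_bipartite m n E \<longleftrightarrow>
     (\<exists>P Q. P \<union> Q = UNIV \<and> P \<inter> Q = {} \<and> card P = m \<and> card Q = n \<and> E = P \<times> Q \<union> Q \<times> P)"

text \<open>\<open>(y, z) \<in> E ^^ n\<close> says that there is a walk of length \<open>n\<close> from \<open>y\<close> to \<open>z\<close>, so the least such
  \<open>n\<close> is the path-length distance (for connected graphs).\<close>

definition gdist :: "'v rel \<Rightarrow> 'v \<Rightarrow> 'v \<Rightarrow> nat" where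
  "gdist E y z = (LEAST n. (y, z) \<in> E ^^ n)"

definition graph_diameter :: "'v::finite rel \<Rightarrow> nat" where
  "graph_diameter E = Max {gdist E y z | y z. True}"

definition Gam :: "'v rel \<Rightarrow> nat \<Rightarrow> 'v \<Rightarrow> 'v set" where
  "Gam E i y = {z. gdist E y z = i}"

definition distance_regular :: "'v::finite rel \<Rightarrow> bool" where
  "distance_regular E \<longleftrightarrow> connected_simple_graph E \<and> graph_diameter E \<ge> 1 \<and>
     (\<forall>h\<le>graph_diameter E. \<forall>i\<le>graph_diameter E. \<forall>j\<le>graph_diameter E.
        \<exists>p. \<forall>y z. gdist E y z = h \<longrightarrow> card (Gam E i y \<inter> Gam E j z) = p)"

text \<open>The number \<open>p\<^sup>h\<^sub>i\<^sub>,\<^sub>j\<close> of a distance-regular graph.\<close>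

definition intersection_number :: "'v::finite rel \<Rightarrow> nat \<Rightarrow> nat \<Rightarrow> nat \<Rightarrow> nat" where
  "intersection_number E h i j =
     (THE p. \<forall>y z. gdist E y z = h \<longrightarrow> card (Gam E i y \<inter> Gam E j z) = p)"

text \<open>The pair of lists \<open>([b\<^sub>0, \<dots>, b\<^sub>D\<^sub>-\<^sub>1], [c\<^sub>1, \<dots>, c\<^sub>D])\<close>.\<close>

definition intersection_array :: "'v::finite rel \<Rightarrow> nat list \<times> nat list" where
  "intersection_array E =
     (map (\<lambda>i. intersection_number E i 1 (i + 1)) [0..<graph_diameter E],
      map (\<lambda>i. intersection_number E i 1 (i - 1)) [1..<graph_diameter E + 1])"

definition adj_matrix :: "'v::finite rel \<Rightarrow> complex^'v^'v" where
  "adj_matrix E = (\<chi> y z. if (y, z) \<in> E then 1 else 0)"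

definition eigenspace :: "complex^'v^'v::finite \<Rightarrow> complex \<Rightarrow> (complex^'v) set" where
  "eigenspace M \<theta> = {v. M *v v = \<theta> *s v}"

text \<open>The eigenvalues of a (real symmetric) matrix paired with their multiplicities.\<close>

definition spectrum_mult :: "complex^'v^'v::finite \<Rightarrow> (complex \<times> nat) set" where
  "spectrum_mult M = {(\<theta>, vec.dim (eigenspace M \<theta>)) | \<theta>. eigenspace M \<theta> \<noteq> {0}}"

section \<open>The Terwilliger algebra\<close>

definition dual_idem :: "'v::finite rel \<Rightarrow> 'v \<Rightarrow> nat \<Rightarrow> complex^'v^'v" where
  "dual_idem E x i = (\<chi> y z. if y = z \<and> gdist E x y = i then 1 else 0)"

definition dual_vec :: "'v::finite rel \<Rightarrow> 'v \<Rightarrow> nat \<Rightarrow> complex^'v" where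
  "dual_vec E x i = (\<chi> y. if gdist E x y = i then 1 else 0)"

definition mat_scale :: "complex \<Rightarrow> complex^'v^'v \<Rightarrow> complex^'v^'v::finite" where
  "mat_scale c M = (\<chi> y z. c * M $ y $ z)"

definition matrix_subalgebra :: "(complex^'v^'v::finite) set \<Rightarrow> bool" where
  "matrix_subalgebra S \<longleftrightarrow> Finite_Cartesian_Product.mat 1 \<in> S \<and>
     (\<forall>M\<in>S. \<forall>N\<in>S. M + N \<in> S \<and> M ** N \<in> S) \<and> (\<forall>c. \<forall>M\<in>S. mat_scale c M \<in> S)"

definition terwilliger :: "'v::finite rel \<Rightarrow> 'v \<Rightarrow> (complex^'v^'v) set" where
  "terwilliger E x =
     matrix_subalgebra hull (insert (adj_matrix E) {dual_idem E x i | i. i \<le> graph_diameter E})"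

definition matrix_space_dim :: "(complex^'v^'v::finite) set \<Rightarrow> nat" where
  "matrix_space_dim = vector_space.dim mat_scale"

lemma vector_space_mat_scale: "vector_space (mat_scale :: complex \<Rightarrow> complex^'v^'v::finite \<Rightarrow> _)"
  by unfold_locales (simp_all add: mat_scale_def vec_eq_iff algebra_simps)

section \<open>Modules of the Terwilliger algebra\<close>

definition cinner :: "complex^'v \<Rightarrow> complex^'v::finite \<Rightarrow> complex" where
  "cinner u v = (\<Sum>y\<in>UNIV. u $ y * cnj (v $ y))"

definition is_module :: "(complex^'v^'v::finite) set \<Rightarrow> (complex^'v) set \<Rightarrow> bool" where
  "is_module T W \<longleftrightarrow> vec.subspace W \<and> (\<forall>B\<in>T. \<forall>w\<in>W. B *v w \<in> W)"

definition irreducible_module :: "(complex^'v^'v::finite) set \<Rightarrow> (complex^'v) set \<Rightarrow> bool" where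
  "irreducible_module T W \<longleftrightarrow> is_module T W \<and> W \<noteq> {0} \<and> \<not> (\<exists>U. is_module T U \<and> U \<noteq> {0} \<and> U \<subset> W)"

definition module_isomorphic ::
    "(complex^'v^'v::finite) set \<Rightarrow> (complex^'v) set \<Rightarrow> (complex^'v) set \<Rightarrow> bool" where
  "module_isomorphic T W W' \<longleftrightarrow>
     (\<exists>f. bij_betw f W W' \<and>
          (\<forall>u\<in>W. \<forall>v\<in>W. f (u + v) = f u + f v) \<and> (\<forall>c. \<forall>u\<in>W. f (c *s u) = c *s f u) \<and>
          (\<forall>B\<in>T. \<forall>u\<in>W. f (B *v u) = B *v f u))"

text \<open>Pairwise orthogonal subspaces have a direct sum, so the third condition says that \<open>V\<close> is the
  orthogonal direct sum of the listed subspaces.\<close>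

definition orthogonal_decomposition ::
    "(complex^'v^'v::finite) set \<Rightarrow> (complex^'v) set list \<Rightarrow> bool" where
  "orthogonal_decomposition T Ws \<longleftrightarrow>
     (\<forall>W\<in>set Ws. irreducible_module T W) \<and>
     (\<forall>i<length Ws. \<forall>j<length Ws. i \<noteq> j \<longrightarrow> (\<forall>u\<in>Ws!i. \<forall>v\<in>Ws!j. cinner u v = 0)) \<and>
     vec.span (\<Union>(set Ws)) = UNIV"

definition multiplicity :: "(complex^'v^'v::finite) set \<Rightarrow> (complex^'v) set \<Rightarrow> nat" where
  "multiplicity T W =
     (THE m. \<exists>Ws. orthogonal_decomposition T Ws \<and> m = length (filter (module_isomorphic T W) Ws))"

definition subconstituent ::
    "'v::finite rel \<Rightarrow> 'v \<Rightarrow> nat \<Rightarrow> (complex^'v) set \<Rightarrow> (complex^'v) set" where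
  "subconstituent E x i W = (*v) (dual_idem E x i) ` W"

definition endpoint :: "'v::finite rel \<Rightarrow> 'v \<Rightarrow> (complex^'v) set \<Rightarrow> nat" where
  "endpoint E x W = Min {i. i \<le> graph_diameter E \<and> subconstituent E x i W \<noteq> {0}}"

definition module_diameter :: "'v::finite rel \<Rightarrow> 'v \<Rightarrow> (complex^'v) set \<Rightarrow> nat" where
  "module_diameter E x W = card {i. i \<le> graph_diameter E \<and> subconstituent E x i W \<noteq> {0}} - 1"

definition module_shape :: "'v::finite rel \<Rightarrow> 'v \<Rightarrow> (complex^'v) set \<Rightarrow> nat list" where
  "module_shape E x W =
     map (\<lambda>i. vec.dim (subconstituent E x i W))
       [endpoint E x W ..< endpoint E x W + module_diameter E x W + 1]"

definition pure :: "'v::finite rel \<Rightarrow> 'v \<Rightarrow> nat \<Rightarrow> complex^'v \<Rightarrow> bool" where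
  "pure E x i v \<longleftrightarrow> v \<noteq> 0 \<and> v \<in> subconstituent E x i UNIV"

text \<open>The coordinates of \<open>v\<close> at the vertices \<open>ys\<close>, where \<open>ys\<close> is an ordering of some \<open>\<Gamma>\<^sub>i(x)\<close>.\<close>

definition essential_part :: "'v::finite list \<Rightarrow> complex^'v \<Rightarrow> complex list" where
  "essential_part ys v = map (\<lambda>y. v $ y) ys"

definition pure_basis ::
    "'v::finite rel \<Rightarrow> 'v \<Rightarrow> (complex^'v) set \<Rightarrow> (complex^'v) list \<Rightarrow> bool" where
  "pure_basis E x W vs \<longleftrightarrow>
     distinct vs \<and> vec.independent (set vs) \<and> vec.span (set vs) = W \<and>
     (\<exists>ss. length ss = length vs \<and> sorted ss \<and> (\<forall>k<length vs. pure E x (ss!k) (vs!k)))"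

definition represents ::
    "complex^'v^'v::finite \<Rightarrow> (complex^'v) list \<Rightarrow> complex Matrix.mat \<Rightarrow> bool" where
  "represents M vs B \<longleftrightarrow> B \<in> carrier_mat (length vs) (length vs) \<and>
     (\<forall>j<length vs. M *v (vs!j) = (\<Sum>i<length vs. B $$ (i, j) *s (vs!i)))"

text \<open>The data of a module \<open>W\<close>: endpoint \<open>r\<close>, multiplicity \<open>m\<close>, dimension \<open>d\<close>, diameter \<open>\<delta>\<close>,
  shape \<open>sh\<close>, a pure basis \<open>vs\<close>, and the matrix \<open>B\<close> representing \<open>A\<close> with respect to it.\<close>

definition has_data ::
    "'v::finite rel \<Rightarrow> 'v \<Rightarrow> (complex^'v) set \<Rightarrow> nat \<Rightarrow> nat \<Rightarrow> nat \<Rightarrow> nat \<Rightarrow> nat list \<Rightarrow>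
     (complex^'v) list \<Rightarrow> complex Matrix.mat \<Rightarrow> bool" where
  "has_data E x W r m d \<delta> sh vs B \<longleftrightarrow>
     endpoint E x W = r \<and> multiplicity (terwilliger E x) W = m \<and> vec.dim W = d \<and>
     module_diameter E x W = \<delta> \<and> module_shape E x W = sh \<and>
     pure_basis E x W vs \<and> represents (adj_matrix E) vs B"

text \<open>\<open>\<nu>\<close> is the seed vector of \<open>W\<close>, with essential part \<open>cs\<close> relative to the ordering \<open>ys\<close> of
  \<open>\<Gamma>\<^sub>r(x)\<close>, where \<open>r\<close> is the endpoint of \<open>W\<close>.\<close>

definition is_seed ::
    "'v::finite rel \<Rightarrow> 'v \<Rightarrow> (complex^'v) set \<Rightarrow> 'v list \<Rightarrow> complex^'v \<Rightarrow> complex list \<Rightarrow> bool" where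
  "is_seed E x W ys \<nu> cs \<longleftrightarrow>
     pure E x (endpoint E x W) \<nu> \<and> essential_part ys \<nu> = cs \<and>
     vec.span {\<nu>} = subconstituent E x (endpoint E x W) W \<and>
     vec.dim (subconstituent E x (endpoint E x W) W) = 1"

end

(* The Terwilliger algebra of K_{3,3} at x consists of the matrices whose (y,z)-entry depends only on
   the distances of y and z to x, apart from a diagonal term that depends only on the distance of y.
   Hence the radial vectors form an irreducible module, and every vector supported on one Gamma_k(x)
   with coordinate sum 0 spans a module whose isomorphism type depends only on k.  Multiplicities do
   not depend on the decomposition, since for B in T the rank of B is the sum of the dimensions of
   B W over the summands W; taking for B the projections onto the span of e_0^* and onto the sum-zero
   vectors on Gamma_1(x) and Gamma_2(x) detects exactly one type each.
   Conversely, the intersection array determines the graph: since c_2 equals the valency 3,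
   nonadjacent vertices have the same neighbours. *)
theory Submission
  imports Defs
begin

text \<open>\<open>multiplicity\<close> is a definite description over all orthogonal
  decompositions, so exhibiting one decomposition does not evaluate it, and no list of the
  irreducible T-modules is known in advance. The rank count handles both difficulties. It only needs
  that an irreducible W' not annihilated by the chosen B is of the expected type. This holds because
  B w is a nonzero vector of W' in the image of B, and every such vector generates a submodule of
  known type, which irreducibility makes equal to W'. The multiplicity of a type is then the rank of
  a single explicit matrix.\<close>

section \<open>Orthogonal decompositions and multiplicities\<close>

text \<open>Applying \<open>\<phi> i\<close> to a vanishing combination of the \<open>b j\<close>
  isolates one coefficient. The setting is an abstract vector space because the result serves both
  vectors and matrices under \<open>mat_scale\<close>, always with functionals that read off
  entries.\<close>

lemma (in vector_space) dual_family:
  assumes fin: "finite I"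
    and add: "\<And>i u v. i \<in> I \<Longrightarrow> \<phi> i (u + v) = \<phi> i u + \<phi> i v"
    and scale: "\<And>i c v. i \<in> I \<Longrightarrow> \<phi> i (scale c v) = c * \<phi> i v"
    and dual: "\<And>i j. i \<in> I \<Longrightarrow> j \<in> I \<Longrightarrow> \<phi> i (b j) = (if i = j then 1 else 0)"
  shows "inj_on b I" "independent (b ` I)"
proof -
  show inj: "inj_on b I"
    by (rule inj_onI) (metis dual zero_neq_one)
  have zero: "\<phi> i 0 = 0" if "i \<in> I" for i
    using scale[OF that, of 0 0] by simp
  have sum: "\<phi> i (\<Sum>j\<in>J. scale (f j) (b j)) = (\<Sum>j\<in>J. f j * \<phi> i (b j))" if "i \<in> I" for i J f
    by (induction J rule: infinite_finite_induct) (simp_all add: zero add scale that)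
  show "independent (b ` I)"
  proof (rule independent_if_scalars_zero)
    fix f v assume f: "(\<Sum>v\<in>b ` I. scale (f v) v) = 0" and "v \<in> b ` I"
    then obtain i where i: "i \<in> I" "v = b i" by blast
    have "(\<Sum>j\<in>I. scale (f (b j)) (b j)) = 0"
      using f by (simp add: sum.reindex[OF inj])
    then have "(\<Sum>j\<in>I. f (b j) * \<phi> i (b j)) = 0"
      using sum[OF i(1), where J = I] zero[OF i(1)] by metis
    moreover have "(\<Sum>j\<in>I. f (b j) * \<phi> i (b j)) = (\<Sum>j\<in>I. if i = j then f (b j) else 0)"
      using i by (intro sum.cong) (auto simp: dual)
    ultimately show "f v = 0"
      using fin i by simp
  qed (use fin in simp)
qed

lemma (in vector_space) dim_eq_card_dual_family:
  assumes "finite I"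
    and "\<And>i u v. i \<in> I \<Longrightarrow> \<phi> i (u + v) = \<phi> i u + \<phi> i v"
    and "\<And>i c v. i \<in> I \<Longrightarrow> \<phi> i (scale c v) = c * \<phi> i v"
    and "\<And>i j. i \<in> I \<Longrightarrow> j \<in> I \<Longrightarrow> \<phi> i (b j) = (if i = j then 1 else 0)"
    and "\<And>i. i \<in> I \<Longrightarrow> b i \<in> S"
    and expand: "\<And>v. v \<in> S \<Longrightarrow> v = (\<Sum>i\<in>I. scale (\<phi> i v) (b i))"
  shows "dim S = card I"
proof -
  note df = dual_family[of I \<phi> b, OF assms(1-4)]
  have "S \<subseteq> span (b ` I)"
  proof
    fix v assume "v \<in> S"
    have "(\<Sum>i\<in>I. scale (\<phi> i v) (b i)) \<in> span (b ` I)"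
      by (intro span_sum span_scale span_base) auto
    then show "v \<in> span (b ` I)" using expand[OF \<open>v \<in> S\<close>] by simp
  qed
  with df assms(5) show ?thesis
    by (intro dim_unique[of "b ` I"]) (auto simp: card_image)
qed

section \<open>The Hermitian inner product and dimensions of orthogonal sums\<close>

lemma cinner_add_left: "cinner (u + v) w = cinner u w + cinner v w"
  by (simp add: cinner_def algebra_simps sum.distrib)

lemma cinner_scale_left: "cinner (c *s u) w = c * cinner u w"
  by (simp add: cinner_def algebra_simps sum_distrib_left)

lemma cinner_zero_left: "cinner 0 w = 0"
  by (simp add: cinner_def)

lemma cinner_commute: "cinner u v = cnj (cinner v u)"
  by (simp add: cinner_def mult.commute)

lemma cinner_self_eq_0_iff: "cinner u u = 0 \<longleftrightarrow> u = 0"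
proof
  assume "cinner u u = 0"
  then have "complex_of_real (\<Sum>y\<in>UNIV. (cmod (u $ y))\<^sup>2) = 0"
    by (simp add: cinner_def complex_norm_square del: of_real_power)
  then have "(\<Sum>y\<in>UNIV. (cmod (u $ y))\<^sup>2) = 0"
    by (simp only: of_real_eq_0_iff)
  then show "u = 0"
    by (simp add: sum_nonneg_eq_0_iff vec_eq_iff)
qed (simp add: cinner_def)

lemma cinner_eq_0_span_left:
  assumes "\<And>u. u \<in> S \<Longrightarrow> cinner u v = 0" and "u \<in> vec.span S"
  shows "cinner u v = 0"
  using assms(2)
  by (induction rule: vec.span_induct_alt)
    (simp_all add: cinner_zero_left cinner_add_left cinner_scale_left assms(1))

lemma cinner_eq_0_span:
  assumes "\<And>u v. u \<in> S \<Longrightarrow> v \<in> S' \<Longrightarrow> cinner u v = 0" and "u \<in> vec.span S" and "v \<in> vec.span S'"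
  shows "cinner u v = 0"
proof -
  have "cinner v w = 0" if "w \<in> S" for w
    using assms(1)[OF that] assms(3) cinner_commute
    by (metis cinner_eq_0_span_left complex_cnj_zero)
  then have "cinner w v = 0" if "w \<in> S" for w
    using that by (metis cinner_commute complex_cnj_zero)
  then show ?thesis
    using assms(2) cinner_eq_0_span_left by blast
qed

text \<open>A vector common to the head and to the span of the tail is orthogonal to itself, hence
  0, so dimensions add along the list. Lists allow repeated entries, which occur as copies of
  \<open>{0}\<close> when a matrix annihilates several summands.\<close>

lemma dim_span_orthogonal_list:
  assumes "\<And>W. W \<in> set Ws \<Longrightarrow> vec.subspace W"
    and "\<And>i j u v. i < j \<Longrightarrow> j < length Ws \<Longrightarrow> u \<in> Ws ! i \<Longrightarrow> v \<in> Ws ! j \<Longrightarrow> cinner u v = 0"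
  shows "vec.dim (vec.span (\<Union>(set Ws))) = (\<Sum>W\<leftarrow>Ws. vec.dim W)"
  using assms
proof (induction Ws)
  case (Cons W Ws)
  let ?S = "vec.span (\<Union>(set Ws))"
  have W: "vec.subspace W" using Cons.prems by simp
  have IH: "vec.dim ?S = (\<Sum>W\<leftarrow>Ws. vec.dim W)"
  proof (rule Cons.IH)
    show "cinner u v = 0" if "i < j" "j < length Ws" "u \<in> Ws ! i" "v \<in> Ws ! j" for i j u v
      using that Cons.prems(2)[of "Suc i" "Suc j" u v] by simp
  qed (use Cons.prems(1) in simp)
  have "W \<inter> ?S = {0}"
  proof -
    have "cinner u v = 0" if u: "u \<in> W" and "v \<in> \<Union>(set Ws)" for u v
    proof -
      from that(2) obtain j where "j < length Ws" "v \<in> Ws ! j"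
        by (metis UnionE in_set_conv_nth)
      then show ?thesis using u Cons.prems(2)[of 0 "Suc j" u v] by simp
    qed
    then have "u = 0" if "u \<in> W" "u \<in> ?S" for u
      using cinner_eq_0_span[of W "\<Union>(set Ws)" u u] that vec.span_base[of u W]
      by (simp add: cinner_self_eq_0_iff)
    then show ?thesis
      using W vec.subspace_0 vec.span_zero by blast
  qed
  moreover have "vec.span (\<Union>(set (W # Ws))) = {u + v |u v. u \<in> W \<and> v \<in> ?S}"
    by (simp add: vec.span_Un W vec.span_eq_iff[THEN iffD2])
  ultimately show ?case
    using vec.dim_sums_Int[OF W vec.subspace_span[of "\<Union>(set Ws)"]] IH by simp
qed simp

section \<open>Modules, lines and isomorphisms\<close>

lemma is_module_mult: "is_module T W \<Longrightarrow> B \<in> T \<Longrightarrow> w \<in> W \<Longrightarrow> B *v w \<in> W"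
  by (simp add: is_module_def)

text \<open>An isomorphism commutes with B, so being annihilated by an element of T is an
  isomorphism invariant. It is used both to count summands of one type and to tell types
  apart.\<close>

lemma isomorphic_image_zero:
  assumes iso: "module_isomorphic T W W'" and B: "B \<in> T"
    and "is_module T W" and "is_module T W'"
  shows "(*v) B ` W = {0} \<longleftrightarrow> (*v) B ` W' = {0}"
proof -
  obtain f where f: "bij_betw f W W'"
      and scale: "\<And>c u. u \<in> W \<Longrightarrow> f (c *s u) = c *s f u"
      and comm: "\<And>u. u \<in> W \<Longrightarrow> f (B *v u) = B *v f u"
    using iso B unfolding module_isomorphic_def by blast
  have 0: "0 \<in> W" "0 \<in> W'"
    using assms(3,4) by (auto simp: is_module_def vec.subspace_0)
  have f0: "f 0 = 0" using scale[OF 0(1), of 0] by simp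
  have BW: "B *v u \<in> W" if "u \<in> W" for u using assms(3) B that by (rule is_module_mult)
  have inj: "f u = 0 \<longleftrightarrow> u = 0" if "u \<in> W" for u
    using bij_betw_imp_inj_on[OF f] that 0(1) f0 by (metis inj_onD)
  have "(\<forall>u\<in>W. B *v u = 0) \<longleftrightarrow> (\<forall>u\<in>W. B *v f u = 0)"
    using inj BW comm by metis
  also have "\<dots> \<longleftrightarrow> (\<forall>u\<in>W'. B *v u = 0)"
    using bij_betw_imp_surj_on[OF f] by blast
  finally show ?thesis
    using 0 by (auto simp: set_eq_iff image_iff)
qed

lemma irreducible_moduleD:
  "irreducible_module T W \<Longrightarrow> is_module T U \<Longrightarrow> U \<noteq> {0} \<Longrightarrow> U \<subseteq> W \<Longrightarrow> U = W"
  by (auto simp: irreducible_module_def)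

lemma module_isomorphic_refl: "module_isomorphic T W W"
  unfolding module_isomorphic_def by (intro exI[of _ id]) auto

lemma line_is_module:
  assumes "\<And>B. B \<in> T \<Longrightarrow> \<exists>c. B *v v = c *s v"
  shows "is_module T (vec.span {v})"
  unfolding is_module_def
proof (intro conjI ballI vec.subspace_span)
  fix B w assume "B \<in> T" "w \<in> vec.span {v}"
  then obtain c where "w = c *s v" by (auto simp: vec.span_singleton)
  moreover obtain d where "B *v v = d *s v" using assms \<open>B \<in> T\<close> by blast
  ultimately have "B *v w = (c * d) *s v" by (simp add: vec.scale)
  then show "B *v w \<in> vec.span {v}" by (auto simp: vec.span_singleton)
qed

lemma line_irreducible:
  assumes "\<And>B. B \<in> T \<Longrightarrow> \<exists>c. B *v v = c *s v" and v: "v \<noteq> 0"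
  shows "irreducible_module T (vec.span {v})"
proof -
  have "vec.span {v} \<subseteq> U" if "is_module T U" "U \<noteq> {0}" "U \<subseteq> vec.span {v}" for U
  proof -
    have U: "vec.subspace U" using that(1) by (simp add: is_module_def)
    then obtain u where u: "u \<in> U" "u \<noteq> 0"
      using \<open>U \<noteq> {0}\<close> vec.subspace_0 by blast
    then obtain c where c: "u = c *s v" using \<open>U \<subseteq> _\<close> by (auto simp: vec.span_singleton)
    then have "v = inverse c *s u" using u(2) by auto
    then have "v \<in> U" using U u(1) by (metis vec.subspace_scale)
    then show ?thesis using U by (simp add: vec.span_minimal)
  qed
  moreover have "vec.span {v} \<noteq> {0}" using v vec.span_base[of v "{v}"] by auto
  ultimately show ?thesis
    using line_is_module[of T v, OF assms(1)] by (auto simp: irreducible_module_def)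
qed

text \<open>T acts on both lines through the same scalars, so matching the spanning vectors gives an
  intertwining map.\<close>

lemma lines_isomorphic:
  assumes vw: "\<And>B. B \<in> T \<Longrightarrow> \<exists>c. B *v v = c *s v \<and> B *v w = c *s w"
    and v: "v \<noteq> 0" and w: "w \<noteq> 0"
  shows "module_isomorphic T (vec.span {v}) (vec.span {w})"
proof -
  \<comment> \<open>The inner product extracts the coefficient of u along v, which makes f linear on
    the whole space.\<close>
  define f where "f u = (cinner u v / cinner v v) *s w" for u
  have vv: "cinner v v \<noteq> 0" using v by (simp add: cinner_self_eq_0_iff)
  have f: "f (c *s v) = c *s w" for c
    using vv by (simp add: f_def cinner_scale_left)
  have "bij_betw f (vec.span {v}) (vec.span {w})"
    unfolding bij_betw_def inj_on_def vec.span_singleton using v w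
    by (auto simp: f image_iff)
  moreover have "f (u + u') = f u + f u'" for u u'
    by (simp add: f_def cinner_add_left add_divide_distrib vector_sadd_rdistrib)
  moreover have "f (c *s u) = c *s f u" for c u
    by (simp add: f_def cinner_scale_left)
  moreover have "f (B *v u) = B *v f u" if "B \<in> T" "u \<in> vec.span {v}" for B u
  proof -
    from that(2) obtain c where "u = c *s v" by (auto simp: vec.span_singleton)
    moreover obtain d where "B *v v = d *s v" "B *v w = d *s w" using vw \<open>B \<in> T\<close> by blast
    ultimately show ?thesis
      using f[of "c * d"] f[of c] by (simp add: vec.scale)
  qed
  ultimately show ?thesis
    unfolding module_isomorphic_def by blast
qed

text \<open>Each summand V is invariant under B, so the images B V remain pairwise orthogonal and
  together span the range of B. A summand contributes 1 if it is isomorphic to W and 0 otherwise.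
  \<open>dec\<close> gives existence in the definite description, and \<open>count\<close> gives
  uniqueness.\<close>

lemma multiplicity_eq_rank:
  assumes dec: "orthogonal_decomposition T Ws" and W: "W \<in> set Ws" and B: "B \<in> T"
    and BW: "(*v) B ` W \<noteq> {0}"
    and other: "\<And>W'. irreducible_module T W' \<Longrightarrow> (*v) B ` W' \<noteq> {0} \<Longrightarrow>
       module_isomorphic T W W' \<and> vec.dim ((*v) B ` W') = 1"
  shows "multiplicity T W = vec.dim (range ((*v) B))"
proof -
  have modW: "is_module T W"
    using dec W by (auto simp: orthogonal_decomposition_def irreducible_module_def)
  have count: "length (filter (module_isomorphic T W) Vs) = vec.dim (range ((*v) B))"
    if Vs: "orthogonal_decomposition T Vs" for Vs
  proof -
    have irr: "irreducible_module T V" if "V \<in> set Vs" for V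
      using Vs that by (simp add: orthogonal_decomposition_def)
    have sub: "vec.subspace V" if "V \<in> set Vs" for V
      using irr[OF that] by (simp add: irreducible_module_def is_module_def)
    have BV: "(*v) B ` V \<subseteq> V" if "V \<in> set Vs" for V
      using irr[OF that] B by (auto simp: irreducible_module_def is_module_def)
    have "length (filter (module_isomorphic T W) Vs) = (\<Sum>V\<leftarrow>Vs. if module_isomorphic T W V then 1 else 0)"
      by (induction Vs) auto
    also have "\<dots> = (\<Sum>V\<leftarrow>Vs. vec.dim ((*v) B ` V))"
    proof (rule arg_cong[where f = sum_list], rule map_cong[OF refl])
      fix V assume V: "V \<in> set Vs"
      \<comment> \<open>From left to right, nonvanishing of the image is transported by the
        isomorphism; from right to left this is \<open>other\<close>.\<close>
      have "module_isomorphic T W V \<longleftrightarrow> (*v) B ` V \<noteq> {0}"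
        using isomorphic_image_zero[of T W V B] B BW modW irr[OF V] other[OF irr[OF V]]
        by (auto simp: irreducible_module_def)
      then show "(if module_isomorphic T W V then 1 else 0) = vec.dim ((*v) B ` V)"
        using other[OF irr[OF V]] by auto
    qed
    also have "\<dots> = (\<Sum>U\<leftarrow>map ((`) ((*v) B)) Vs. vec.dim U)"
      by (simp add: comp_def)
    also have "\<dots> = vec.dim (vec.span (\<Union>(set (map ((`) ((*v) B)) Vs))))"
    proof (rule dim_span_orthogonal_list[symmetric])
      show "cinner u v = 0" if "i < j" "j < length (map ((`) ((*v) B)) Vs)"
        "u \<in> map ((`) ((*v) B)) Vs ! i" "v \<in> map ((`) ((*v) B)) Vs ! j" for i j u v
      proof -
        have "u \<in> Vs ! i" "v \<in> Vs ! j"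
          using that BV[OF nth_mem, of i] BV[OF nth_mem, of j] by auto
        then show ?thesis
          using Vs that(1,2) unfolding orthogonal_decomposition_def
          by (metis length_map less_trans nat_neq_iff)
      qed
    qed (auto intro: sub vec.subspace_image)
    also have "\<Union>(set (map ((`) ((*v) B)) Vs)) = (*v) B ` \<Union>(set Vs)"
      by auto
    also have "vec.span ((*v) B ` \<Union>(set Vs)) = (*v) B ` vec.span (\<Union>(set Vs))"
      by (rule vec.span_image)
    finally show ?thesis
      using Vs by (simp add: orthogonal_decomposition_def)
  qed
  show ?thesis
    unfolding multiplicity_def using dec count by (intro the_equality) auto
qed

section \<open>Complete bipartite graphs and distance-regularity\<close>

lemma relpow_gdist: "connected_simple_graph E \<Longrightarrow> (y, z) \<in> E ^^ gdist E y z"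
proof -
  assume "connected_simple_graph E"
  then have "(y, z) \<in> E\<^sup>*" by (simp add: connected_simple_graph_def)
  then obtain n where "(y, z) \<in> E ^^ n" by (auto dest: rtrancl_imp_relpow)
  then show ?thesis unfolding gdist_def by (rule LeastI)
qed

lemma gdist_le: "(y, z) \<in> E ^^ n \<Longrightarrow> gdist E y z \<le> n"
  unfolding gdist_def by (rule Least_le)

lemma gdist_eq_0_iff: "connected_simple_graph E \<Longrightarrow> gdist E y z = 0 \<longleftrightarrow> y = z"
  using relpow_gdist[of E y z] gdist_le[of y z 0 E] by auto

lemma gdist_eq_1_iff:
  assumes E: "connected_simple_graph E"
  shows "gdist E y z = 1 \<longleftrightarrow> (y, z) \<in> E"
proof
  assume "gdist E y z = 1"
  then show "(y, z) \<in> E" using relpow_gdist[OF E, of y z] by simp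
next
  assume yz: "(y, z) \<in> E"
  then have "y \<noteq> z" using E by (auto simp: connected_simple_graph_def irrefl_def)
  then show "gdist E y z = 1"
    using gdist_le[of y z 1 E] yz gdist_eq_0_iff[OF E, of y z] by simp
qed

lemma gdist_le_graph_diameter: "gdist E y z \<le> graph_diameter E"
proof -
  have "{gdist E y z |y z. True} = range (\<lambda>(y, z). gdist E y z)" by auto
  then show ?thesis unfolding graph_diameter_def by (intro Max_ge) auto
qed

text \<open>The pair y, z itself witnesses that the distance occurs, which makes the value described
  by \<open>THE\<close> unique.\<close>

lemma card_eq_intersection_number:
  assumes "distance_regular E" and "i \<le> graph_diameter E" and "j \<le> graph_diameter E"
  shows "card (Gam E i y \<inter> Gam E j z) = intersection_number E (gdist E y z) i j"
proof -
  let ?R = "\<lambda>p. \<forall>y' z'. gdist E y' z' = gdist E y z \<longrightarrow> card (Gam E i y' \<inter> Gam E j z') = p"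
  obtain p where p: "?R p"
    using assms gdist_le_graph_diameter[of E y z] unfolding distance_regular_def by blast
  then have "intersection_number E (gdist E y z) i j = p"
    unfolding intersection_number_def by (intro the_equality) auto
  then show ?thesis using p by blast
qed

lemma complete_bipartite_gdist:
  assumes PQ: "P \<union> Q = UNIV" "P \<inter> Q = {}" and ne: "P \<noteq> {}" "Q \<noteq> {}"
    and E: "E = P \<times> Q \<union> Q \<times> P"
  shows "connected_simple_graph E"
    and "gdist E y z = (if y = z then 0 else if (y, z) \<in> E then 1 else 2)"
proof -
  \<comment> \<open>Nonadjacent vertices lie on the same side and share every vertex of the other
    side as a neighbour. This includes y = z, where the walk goes to a neighbour and back.\<close>
  have two: "(y, z) \<in> E ^^ 2" if "(y, z) \<notin> E" for y z
  proof -
    have "\<exists>w. (y, w) \<in> E \<and> (w, z) \<in> E"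
    proof (cases "y \<in> P")
      case True
      then show ?thesis using that PQ ne E by blast
    next
      case False
      then have "y \<in> Q" using PQ by auto
      then show ?thesis using that PQ ne E by blast
    qed
    then show ?thesis by (auto simp: numeral_2_eq_2)
  qed
  have "(y, z) \<in> E\<^sup>*" for y z
    using two[of y z] relpow_imp_rtrancl by blast
  then show conn: "connected_simple_graph E"
    using PQ E by (auto simp: connected_simple_graph_def sym_def irrefl_def)
  show "gdist E y z = (if y = z then 0 else if (y, z) \<in> E then 1 else 2)"
    using gdist_eq_0_iff[OF conn, of y z] gdist_eq_1_iff[OF conn, of y z]
      gdist_le[OF two, of y z] by (cases "y = z"; cases "(y, z) \<in> E"; simp; linarith)
qed

lemma complete_bipartite_graph_diameter:
  assumes PQ: "P \<union> Q = UNIV" "P \<inter> Q = {}" and ne: "P \<noteq> {}" and card: "card Q \<ge> 2"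
    and E: "E = P \<times> Q \<union> Q \<times> P"
  shows "graph_diameter E = 2"
proof -
  have Qne: "Q \<noteq> {}" using card by auto
  note gd = complete_bipartite_gdist(2)[OF PQ ne Qne E]
  obtain y z where "y \<in> Q" "z \<in> Q" "y \<noteq> z"
    using card by (metis card_2_iff' ex_card subsetD)
  then have "gdist E y z = 2"
    using gd PQ E by auto
  then have "2 \<le> graph_diameter E" using gdist_le_graph_diameter by metis
  moreover have "graph_diameter E \<le> 2"
  proof -
    have "{gdist E y z |y z. True} = range (\<lambda>(y, z). gdist E y z)" by auto
    then show ?thesis unfolding graph_diameter_def
      by (subst Max_le_iff) (auto simp: gd)
  qed
  ultimately show ?thesis by simp
qed

text \<open>The table of the numbers \<open>p\<^sup>h\<^sub>i\<^sub>,\<^sub>j\<close> of \<open>K\<^sub>3\<^sub>,\<^sub>3\<close>, for \<open>h, i, j \<le> 2\<close>.\<close>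

definition K33_number :: "nat \<Rightarrow> nat \<Rightarrow> nat \<Rightarrow> nat" where
  "K33_number h i j =
    (if h = 0 then if i = j then [1, 3, 2] ! i else 0
     else if h = 1 then if i + j = 1 then 1 else if i + j = 3 then 2 else 0
     else if i = j then [0, 3, 1] ! i else if i + j = 2 then 1 else 0)"

text \<open>The vertices at distance 0, 1, 2 from y are y, the opposite side \<open>N y\<close>, and
  the rest of its own side \<open>S y\<close>. In each case for the distance of y and z, the sides
  of z are rewritten as those of y, and only set algebra with two disjoint 3-sets remains.\<close>

lemma complete_bipartite_3_3_card_Gam:
  assumes "complete_bipartite 3 3 E" and "i \<le> 2" and "j \<le> 2"
  shows "card (Gam E i y \<inter> Gam E j z) = K33_number (gdist E y z) i j"
proof -
  from assms obtain P Q where PQ: "P \<union> Q = UNIV" "P \<inter> Q = {}" and card: "card P = 3" "card Q = 3"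
    and E: "E = P \<times> Q \<union> Q \<times> P"
    unfolding complete_bipartite_def by blast
  have ne: "P \<noteq> {}" "Q \<noteq> {}" using card by auto
  note gd = complete_bipartite_gdist(2)[OF PQ ne E]
  define S where "S y = (if y \<in> P then P else Q)" for y
  define N where "N y = (if y \<in> P then Q else P)" for y
  have SN: "card (S y) = 3" "card (N y) = 3" "S y \<inter> N y = {}" "N y \<inter> S y = {}" "y \<in> S y" "y \<notin> N y" for y
    using PQ card by (auto simp: S_def N_def)
  have G0: "Gam E 0 y = {y}" for y by (auto simp: Gam_def gd)
  have mem: "(y, z) \<in> E \<longleftrightarrow> z \<in> N y" for y z using PQ by (auto simp: E N_def)
  have G1: "Gam E (Suc 0) y = N y" for y using SN(6) by (auto simp: Gam_def gd mem)
  have G2: "Gam E 2 y = S y - {y}" for y using PQ by (auto simp: Gam_def gd mem N_def S_def)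
  have ij: "i = 0 \<or> i = Suc 0 \<or> i = 2" "j = 0 \<or> j = Suc 0 \<or> j = 2" using assms(2,3) by auto
  consider "y = z" "gdist E y z = 0" | "(y, z) \<in> E" "y \<noteq> z" "gdist E y z = 1"
    | "(y, z) \<notin> E" "y \<noteq> z" "gdist E y z = 2"
    using SN(6) by (auto simp: gd mem)
  then show ?thesis
  proof cases
    case 1
    moreover have "{y} \<inter> N y = {}" "N y \<inter> {y} = {}" "{y} \<inter> (S y - {y}) = {}"
      "(S y - {y}) \<inter> {y} = {}" "N y \<inter> (S y - {y}) = {}" "(S y - {y}) \<inter> N y = {}"
      using SN[of y] by auto
    ultimately show ?thesis using ij SN[of y] by (elim disjE) (simp_all add: G0 G1 G2 K33_number_def)
  next
    case 2
    have z: "N z = S y" "S z = N y" "z \<in> N y" using 2 PQ E by (auto simp: S_def N_def)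
    then have "{y} \<inter> {z} = {}" "{y} \<inter> S y = {y}" "{y} \<inter> (N y - {z}) = {}"
      "N y \<inter> {z} = {z}" "N y \<inter> (N y - {z}) = N y - {z}"
      "(S y - {y}) \<inter> {z} = {}" "(S y - {y}) \<inter> S y = S y - {y}" "(S y - {y}) \<inter> (N y - {z}) = {}"
      using 2 SN[of y] by auto
    with 2 z ij SN[of y] show ?thesis by (elim disjE) (simp_all add: G0 G1 G2 K33_number_def)
  next
    case 3
    have z: "N z = N y" "S z = S y" "z \<in> S y" using 3 PQ E by (auto simp: S_def N_def)
    then have "{y} \<inter> {z} = {}" "{y} \<inter> N y = {}" "{y} \<inter> (S y - {z}) = {y}"
      "N y \<inter> {z} = {}" "N y \<inter> (S y - {z}) = {}"
      "(S y - {y}) \<inter> {z} = {z}" "(S y - {y}) \<inter> N y = {}"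
      "(S y - {y}) \<inter> (S y - {z}) = S y - {y, z}"
      using 3 SN[of y] by auto
    moreover have "card (S y - {y, z}) = 1"
      using 3 z SN[of y] by (simp add: card_Diff_subset)
    ultimately show ?thesis using 3 z ij SN[of y] by (elim disjE) (simp_all add: G0 G1 G2 K33_number_def)
  qed
qed

lemma complete_bipartite_3_3_intersection_array:
  assumes K: "complete_bipartite 3 3 (E :: 'v::finite rel)"
  shows "distance_regular E" "CARD('v) = 6" "intersection_array E = ([3, 2], [1, 3])"
    and "graph_diameter E = 2"
proof -
  from K obtain P Q where PQ: "P \<union> Q = UNIV" "P \<inter> Q = {}" and card: "card P = 3" "card Q = 3"
    and E: "E = P \<times> Q \<union> Q \<times> P"
    unfolding complete_bipartite_def by blast
  have ne: "P \<noteq> {}" "Q \<noteq> {}" and "2 \<le> card Q" using card by auto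
  note gd = complete_bipartite_gdist(2)[OF PQ ne E]
  show D: "graph_diameter E = 2"
    using complete_bipartite_graph_diameter[OF PQ ne(1) \<open>2 \<le> card Q\<close> E] .
  note c = complete_bipartite_3_3_card_Gam[OF K]
  show "CARD('v) = 6"
    using card PQ card_Un_disjoint[of P Q] by simp
  show dr: "distance_regular E"
    unfolding distance_regular_def D
    using complete_bipartite_gdist(1)[OF PQ ne E] by (auto simp: c)
  \<comment> \<open>One pair at each of the distances 0, 1, 2 is enough to evaluate the intersection
    numbers in the array.\<close>
  obtain y z where yz: "y \<in> Q" "z \<in> Q" "y \<noteq> z"
    using \<open>2 \<le> card Q\<close> by (metis card_2_iff' ex_card subsetD)
  obtain w where w: "w \<in> P" using ne by blast
  have g: "gdist E y y = 0" "gdist E y w = 1" "gdist E y z = 2"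
    unfolding gd using yz w PQ by (auto simp: E)
  note I = card_eq_intersection_number[OF dr, unfolded D]
  have "intersection_number E 0 1 1 = 3" "intersection_number E 1 1 2 = 2"
    "intersection_number E 1 1 0 = 1" "intersection_number E 2 1 1 = 3"
    using I[of 1 1 y y] c[of 1 1 y y] I[of 1 2 y w] I[of 1 0 y w] I[of 1 1 y z] g by (auto simp: c K33_number_def)
  then show "intersection_array E = ([3, 2], [1, 3])"
    by (simp add: intersection_array_def D upt_rec numeral_2_eq_2 numeral_3_eq_3)
qed

text \<open>Once nonadjacent vertices share their neighbourhood, the neighbourhood Q of one vertex
  is the neighbourhood of every vertex outside Q. Counting 6 - 3 = 3 then forces each vertex of Q to
  have exactly the complement of Q as its neighbourhood.\<close>

lemma complete_bipartite_3_3I: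
  assumes dr: "distance_regular (E :: 'v::finite rel)" and n: "CARD('v) = 6"
    and arr: "intersection_array E = ([3, 2], [1, 3])"
  shows "complete_bipartite 3 3 E"
proof -
  have conn: "connected_simple_graph E" using dr by (simp add: distance_regular_def)
  have "length (fst (intersection_array E)) = 2" by (simp add: arr)
  then have D: "graph_diameter E = 2" by (simp add: intersection_array_def)
  \<comment> \<open>The two entries equal to 3 are b_0 = p^0_{1,1}, the valency, and c_2 =
    p^2_{1,1}, the number of common neighbours at distance 2.\<close>
  have p: "intersection_number E 0 1 1 = 3" "intersection_number E 2 1 1 = 3"
    using arr by (auto simp: intersection_array_def D upt_rec numeral_2_eq_2 numeral_3_eq_3)
  have G: "Gam E 1 y = E `` {y}" for y
    using gdist_eq_1_iff[OF conn] by (auto simp: Gam_def)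
  note I = card_eq_intersection_number[OF dr, of 1 1, unfolded D G]
  have deg: "card (E `` {y}) = 3" for y
    using I[of y y] p gdist_eq_0_iff[OF conn, of y y] by simp
  have nonadj: "E `` {y} = E `` {z}" if "(y, z) \<notin> E" for y z
  proof (cases "y = z")
    case False
    then have "gdist E y z = 2"
      using that gdist_le_graph_diameter[of E y z] gdist_eq_0_iff[OF conn, of y z]
        gdist_eq_1_iff[OF conn, of y z] D by linarith
    then have "card (E `` {y} \<inter> E `` {z}) = 3" using I[of y z] p by simp
    then have "E `` {y} \<inter> E `` {z} = E `` {y}" "E `` {y} \<inter> E `` {z} = E `` {z}"
      using deg by (metis card_subset_eq finite Int_lower1, metis card_subset_eq finite Int_lower2)
    then show ?thesis by simp
  qed simp
  \<comment> \<open>Here \<open>undefined\<close> merely names some vertex; any other would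
    do.\<close>
  define Q where "Q = E `` {undefined}"
  have P: "E `` {y} = Q" if "y \<in> - Q" for y
    using that nonadj[of undefined y] by (auto simp: Q_def)
  have card: "card Q = 3" "card (- Q) = 3"
    using deg n by (simp_all add: Q_def Compl_eq_Diff_UNIV card_Diff_subset)
  have "sym E" using conn by (simp add: connected_simple_graph_def)
  have Q: "E `` {y} = - Q" if "y \<in> Q" for y
  proof -
    have "- Q \<subseteq> E `` {y}" using P that \<open>sym E\<close> by (auto dest: symD)
    then show ?thesis using card deg[of y] card_subset_eq[of "E `` {y}" "- Q"] by simp
  qed
  have "(y, z) \<in> E \<longleftrightarrow> (y \<in> - Q \<and> z \<in> Q \<or> y \<in> Q \<and> z \<in> - Q)" for y z
    using P[of y] Q[of y] by blast
  then have "E = (- Q) \<times> Q \<union> Q \<times> (- Q)" by auto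
  then show ?thesis
    using card unfolding complete_bipartite_def by (intro exI[of _ "- Q"] exI[of _ Q]) auto
qed

section \<open>The Terwilliger algebra of the complete bipartite graph\<close>

text \<open>The parametrisation is redundant: on a class with a single vertex \<open>c i i\<close>
  and \<open>a i\<close> enter only through their sum. The redundancy keeps the product formula
  uniform and has to be removed when the dimension is computed.\<close>

definition block_matrix ::
    "('v::finite \<Rightarrow> nat) \<Rightarrow> (nat \<Rightarrow> nat \<Rightarrow> complex) \<Rightarrow> (nat \<Rightarrow> complex) \<Rightarrow> complex^'v^'v" where
  "block_matrix g c a = (\<chi> y z. c (g y) (g z) + (if y = z then a (g y) else 0))"

lemma block_matrix_add:
  "block_matrix g c a + block_matrix g c' a' =
    block_matrix g (\<lambda>i j. c i j + c' i j) (\<lambda>i. a i + a' i)"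
  by (simp add: block_matrix_def vec_eq_iff)

lemma block_matrix_scale:
  "mat_scale s (block_matrix g c a) = block_matrix g (\<lambda>i j. s * c i j) (\<lambda>i. s * a i)"
  by (simp add: block_matrix_def mat_scale_def vec_eq_iff algebra_simps)

text \<open>Summing block times block over the middle vertex leaves a function of the outer classes,
  and block times diagonal is again a block; only diagonal times diagonal stays diagonal.\<close>

lemma block_matrix_mult:
  "block_matrix g c a ** block_matrix g c' a' =
    block_matrix g (\<lambda>i j. (\<Sum>w\<in>UNIV. c i (g w) * c' (g w) j) + a i * c' i j + c i j * a' j)
      (\<lambda>i. a i * a' i)"
proof -
  have "(\<Sum>w\<in>UNIV. (c (g y) (g w) + (if y = w then a (g y) else 0)) *
           (c' (g w) (g z) + (if w = z then a' (g w) else 0))) =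
        (\<Sum>w\<in>UNIV. c (g y) (g w) * c' (g w) (g z)) + a (g y) * c' (g y) (g z) +
        c (g y) (g z) * a' (g z) + (if y = z then a (g y) * a' (g y) else 0)" for y z
  proof -
    have "(\<Sum>w\<in>UNIV. (c (g y) (g w) + (if y = w then a (g y) else 0)) *
           (c' (g w) (g z) + (if w = z then a' (g w) else 0))) =
        (\<Sum>w\<in>UNIV. c (g y) (g w) * c' (g w) (g z) + (if y = w then a (g y) * c' (g y) (g z) else 0) +
          (if w = z then c (g y) (g z) * a' (g z) else 0) +
          (if w = z then if y = z then a (g y) * a' (g y) else 0 else 0))"
      by (intro sum.cong) (auto simp: algebra_simps)
    then show ?thesis by (simp add: sum.distrib)
  qed
  then show ?thesis
    by (simp add: block_matrix_def matrix_matrix_mult_def vec_eq_iff add.assoc)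
qed

lemma subalgebra_block_matrices: "matrix_subalgebra {block_matrix g c a | c a. True}"
  unfolding matrix_subalgebra_def
proof (intro conjI ballI allI)
  have "Finite_Cartesian_Product.mat 1 = block_matrix g (\<lambda>_ _. 0) (\<lambda>_. 1)"
    by (simp add: block_matrix_def Finite_Cartesian_Product.mat_def vec_eq_iff)
  then show "Finite_Cartesian_Product.mat 1 \<in> {block_matrix g c a | c a. True}" by auto
qed (auto simp: block_matrix_add block_matrix_mult block_matrix_scale, blast+)

text \<open>Naming all six vertices turns sums and quantifiers over the type into finite
  computations. The primed families are \<Gamma>_2(x), with p, and \<Gamma>_1(x), with q, in the
  order in which essential parts will be read.\<close>

locale k33 =
  fixes E :: "'v::finite rel" and x p p' q q' q'' :: 'v
  assumes distinct: "distinct [x, p, p', q, q', q'']"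
    and UNIV_eq: "UNIV = {x, p, p', q, q', q''}"
    and E_eq: "E = {x, p, p'} \<times> {q, q', q''} \<union> {q, q', q''} \<times> {x, p, p'}"
begin

lemma neqs [simp]:
  "x \<noteq> p" "x \<noteq> p'" "x \<noteq> q" "x \<noteq> q'" "x \<noteq> q''" "p \<noteq> x" "p' \<noteq> x" "q \<noteq> x" "q' \<noteq> x" "q'' \<noteq> x"
  "p \<noteq> p'" "p \<noteq> q" "p \<noteq> q'" "p \<noteq> q''" "p' \<noteq> p" "q \<noteq> p" "q' \<noteq> p" "q'' \<noteq> p"
  "p' \<noteq> q" "p' \<noteq> q'" "p' \<noteq> q''" "q \<noteq> p'" "q' \<noteq> p'" "q'' \<noteq> p'"
  "q \<noteq> q'" "q \<noteq> q''" "q' \<noteq> q" "q'' \<noteq> q" "q' \<noteq> q''" "q'' \<noteq> q'"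
  using distinct by auto

lemma bipartite: "complete_bipartite 3 3 E"
  unfolding complete_bipartite_def
proof (intro exI conjI)
  show "E = {x, p, p'} \<times> {q, q', q''} \<union> {q, q', q''} \<times> {x, p, p'}" by (rule E_eq)
  show "{x, p, p'} \<union> {q, q', q''} = UNIV" unfolding UNIV_eq by blast
qed simp_all

lemma sum_vertices: "(\<Sum>w\<in>UNIV. f w) = f x + (f p + (f p' + (f q + (f q' + f q''))))"
  for f :: "'v \<Rightarrow> 'b::comm_monoid_add"
  unfolding UNIV_eq by simp

lemma all_vertices: "(\<forall>y. P y) \<longleftrightarrow> P x \<and> P p \<and> P p' \<and> P q \<and> P q' \<and> P q''"
proof -
  have "(\<forall>y. P y) \<longleftrightarrow> (\<forall>y\<in>{x, p, p', q, q', q''}. P y)"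
    unfolding UNIV_eq[symmetric] by simp
  then show ?thesis by simp
qed

definition g :: "'v \<Rightarrow> nat" where "g = gdist E x"

lemma g_simps [simp]: "g x = 0" "g p = 2" "g p' = 2" "g q = 1" "g q' = 1" "g q'' = 1"
proof -
  have PQ: "{x, p, p'} \<union> {q, q', q''} = UNIV" "{x, p, p'} \<inter> {q, q', q''} = {}"
    by (auto simp: UNIV_eq)
  note gd = complete_bipartite_gdist(2)[OF PQ _ _ E_eq]
  show "g x = 0" "g p = 2" "g p' = 2" "g q = 1" "g q' = 1" "g q'' = 1"
    unfolding g_def by (subst gd; simp add: E_eq)+
qed

lemma diameter [simp]: "graph_diameter E = 2"
  by (rule complete_bipartite_3_3_intersection_array(4)[OF bipartite])

lemma g_le_2 [simp]: "g y \<le> 2"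
  using gdist_le_graph_diameter[of E x y] by (simp add: g_def)

abbreviation T :: "(complex^'v^'v) set" where "T \<equiv> terwilliger E x"

abbreviation Js :: "nat \<Rightarrow> nat \<Rightarrow> complex^'v^'v" where
  "Js i j \<equiv> block_matrix g (\<lambda>k l. if k = i \<and> l = j then 1 else 0) (\<lambda>_. 0)"

lemma dual_idem_eq: "dual_idem E x i = block_matrix g (\<lambda>_ _. 0) (\<lambda>k. if k = i then 1 else 0)"
  by (simp add: dual_idem_def block_matrix_def g_def vec_eq_iff)

text \<open>The side of a vertex is the parity of its distance to x, so adjacency is a function of
  distances and A itself is a block matrix.\<close>

lemma edge_iff: "(y, z) \<in> E \<longleftrightarrow> g y + g z = 1 \<or> g y + g z = 3"
proof -
  have "y \<in> {x, p, p'} \<and> (g y = 0 \<or> g y = 2) \<and> y \<notin> {q, q', q''} \<or>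
      y \<notin> {x, p, p'} \<and> g y = 1 \<and> y \<in> {q, q', q''}" for y
    using all_vertices[of "\<lambda>y. y \<in> {x, p, p'} \<and> (g y = 0 \<or> g y = 2) \<and> y \<notin> {q, q', q''} \<or>
      y \<notin> {x, p, p'} \<and> g y = 1 \<and> y \<in> {q, q', q''}"] by simp
  from this[of y] this[of z] show ?thesis
    unfolding E_eq by (elim disjE conjE) (simp_all only: Un_iff mem_Sigma_iff, simp_all)
qed

lemma adj_matrix_eq:
  "adj_matrix E = block_matrix g (\<lambda>i j. if i + j = 1 \<or> i + j = 3 then 1 else 0) (\<lambda>_. 0)"
  by (simp add: adj_matrix_def block_matrix_def vec_eq_iff edge_iff)

lemma T_generator: "B = adj_matrix E \<or> (\<exists>i\<le>2. B = dual_idem E x i) \<Longrightarrow> B \<in> T"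
  unfolding terwilliger_def by (rule hull_inc) auto

lemma subalgebra_T: "matrix_subalgebra T"
  unfolding terwilliger_def by (rule hull_in) (auto simp: matrix_subalgebra_def)

lemma T_add: "M \<in> T \<Longrightarrow> N \<in> T \<Longrightarrow> M + N \<in> T"
  and T_mult: "M \<in> T \<Longrightarrow> N \<in> T \<Longrightarrow> M ** N \<in> T"
  and T_scale: "M \<in> T \<Longrightarrow> mat_scale c M \<in> T"
  using subalgebra_T by (auto simp: matrix_subalgebra_def)

lemma block_matrix_eqI:
  assumes "\<forall>i\<in>{0, 1, 2}. \<forall>j\<in>{0, 1, 2}. c i j = c' i j" and "\<forall>i\<in>{0, 1, 2}. a i = a' i"
  shows "block_matrix g c a = block_matrix g c' a'"
proof -
  have "g y \<in> {0, 1, 2}" for y using g_le_2[of y] by (auto simp del: g_le_2)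
  then show ?thesis using assms by (simp only: block_matrix_def)
qed

text \<open>Since \<Gamma>_0(x) is a single vertex, \<open>Js i j\<close> factors as
  \<open>Js i 0 ** Js 0 j\<close>. It remains to reach the first row and column of blocks, by
  walking from x with A and cutting down with the dual idempotents.\<close>

lemma Js_in_T:
  assumes "i \<le> 2" and "j \<le> 2"
  shows "Js i j \<in> T"
proof -
  let ?A = "adj_matrix E" and ?E = "dual_idem E x"
  have E: "?E k \<in> T" if "k \<le> 2" for k using that by (intro T_generator) auto
  have A: "?A \<in> T" by (intro T_generator) simp
  have 00: "Js 0 0 = ?E 0"
    by (simp add: dual_idem_eq block_matrix_def vec_eq_iff all_vertices)
  have 10: "Js 1 0 = ?E 1 ** ?A ** ?E 0" and 01: "Js 0 1 = ?E 0 ** ?A ** ?E 1"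
    unfolding adj_matrix_eq dual_idem_eq block_matrix_mult
    by (rule block_matrix_eqI; simp add: sum_vertices)+
  \<comment> \<open>The factor 1/3 cancels the number of walks of length 2 between x and a vertex of
    \<Gamma>_2(x).\<close>
  have 20: "Js 2 0 = mat_scale (1/3) (?E 2 ** ?A ** Js 1 0)"
    and 02: "Js 0 2 = mat_scale (1/3) (Js 0 1 ** ?A ** ?E 2)"
    unfolding adj_matrix_eq dual_idem_eq block_matrix_mult block_matrix_scale
    by (rule block_matrix_eqI; simp add: sum_vertices)+
  have T10: "Js 1 0 \<in> T" and T01: "Js 0 1 \<in> T"
    unfolding 10 01 by (intro T_mult A E; simp)+
  have k0: "Js k 0 \<in> T \<and> Js 0 k \<in> T" if "k \<le> 2" for k
  proof -
    have "Js 2 0 \<in> T" "Js 0 2 \<in> T"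
      unfolding 20 02 by (intro T_scale T_mult T10 T01 A E; simp)+
    moreover have "Js 0 0 \<in> T" unfolding 00 by (rule E) simp
    moreover have "k = 0 \<or> k = 1 \<or> k = 2" using that by auto
    ultimately show ?thesis using T10 T01 by auto
  qed
  have ij: "Js i j = Js i 0 ** Js 0 j"
    unfolding block_matrix_mult by (rule block_matrix_eqI) (simp_all add: sum_vertices)
  show ?thesis unfolding ij using k0 assms by (intro T_mult) blast+
qed

lemma block_matrix_expand:
  "block_matrix g c a =
    (\<Sum>i\<le>2. \<Sum>j\<le>2. mat_scale (c i j) (Js i j)) + (\<Sum>i\<le>2. mat_scale (a i) (dual_idem E x i))"
proof -
  have "(\<Sum>i\<le>2. \<Sum>j\<le>2. c i j * (if g y = i \<and> g z = j then 1 else 0)) = c (g y) (g z)" for y z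
  proof -
    have "(\<Sum>i\<le>2. \<Sum>j\<le>2. c i j * (if g y = i \<and> g z = j then 1 else 0)) =
        (\<Sum>i\<le>2. \<Sum>j\<le>2. if g z = j then if g y = i then c i (g z) else 0 else 0)"
      by (intro sum.cong) auto
    then show ?thesis by simp
  qed
  moreover have "(\<Sum>i\<le>2. a i * (if y = z then if g y = i then 1 else 0 else 0)) =
      (if y = z then a (g y) else 0)" for y z
    by (cases "y = z") (simp_all add: if_distrib[of "(*) _"] cong: if_cong)
  ultimately show ?thesis
    by (simp add: vec_eq_iff block_matrix_def mat_scale_def dual_idem_eq)
qed

lemma T_eq: "T = {block_matrix g c a | c a. True}"
proof
  show "T \<subseteq> {block_matrix g c a | c a. True}"
    unfolding terwilliger_def
  proof (intro hull_minimal subalgebra_block_matrices)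
    show "insert (adj_matrix E) {dual_idem E x i |i. i \<le> graph_diameter E} \<subseteq> {block_matrix g c a | c a. True}"
      unfolding adj_matrix_eq dual_idem_eq by (auto intro: exI)
  qed
  have zero: "0 \<in> T"
    using T_scale[of "adj_matrix E" 0] T_generator[of "adj_matrix E"]
    by (simp add: mat_scale_def zero_vec_def)
  have sum: "(\<Sum>i\<in>I. f i) \<in> T" if "\<And>i. i \<in> I \<Longrightarrow> f i \<in> T" for I :: "nat set" and f
    using that by (induction I rule: infinite_finite_induct) (auto intro: zero T_add)
  have "block_matrix g c a \<in> T" for c a
    by (subst block_matrix_expand) (intro T_add sum T_scale Js_in_T T_generator; auto)
  then show "{block_matrix g c a | c a. True} \<subseteq> T" by blast
qed

lemma block_matrix_in_T: "block_matrix g c a \<in> T"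
  unfolding T_eq by blast

text \<open>The coordinate functionals dual to the basis \<open>Js i j\<close>, \<open>E\<^sub>1\<^sup>*\<close>, \<open>E\<^sub>2\<^sup>*\<close> read off entries at representatives
  \<open>R i\<close>, \<open>C j\<close> of the distance classes, which differ except for \<open>R 0 = C 0 = x\<close>.\<close>

lemma matrix_space_dim_T: "matrix_space_dim T = 11"
proof -
  interpret M: vector_space "mat_scale :: complex \<Rightarrow> complex^'v^'v \<Rightarrow> _"
    by (rule vector_space_mat_scale)
  define R where "R = (!) [x, q, p]"
  define C where "C = (!) [x, q', p']"
  define b where "b = case_sum (\<lambda>(i, j). Js i j) (dual_idem E x)"
  define \<phi> where "\<phi> = case_sum (\<lambda>(i, j) M. M $ R i $ C j) (\<lambda>k M. M $ R k $ R k - M $ R k $ C k :: complex)"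
  \<comment> \<open>Nine blocks and two idempotents: \<open>dual_idem E x 0\<close> coincides with
    \<open>Js 0 0\<close>, so the index 0 is left out on the right.\<close>
  define I :: "(nat \<times> nat + nat) set" where "I = ({..2} \<times> {..2}) <+> {1, 2}"
  have le2: "i \<le> 2 \<longleftrightarrow> i = 0 \<or> i = 1 \<or> i = 2" for i :: nat by auto
  have atMost2: "{..2::nat} = {0, 1, 2}" by auto
  have "M.dim T = card I"
  proof (rule M.dim_eq_card_dual_family)
    show "finite I" by (simp add: I_def)
    show "\<phi> i (u + v) = \<phi> i u + \<phi> i v" for i u v
      by (simp add: \<phi>_def split: sum.split prod.split)
    show "\<phi> i (mat_scale c v) = c * \<phi> i v" for i c v
      by (simp add: \<phi>_def mat_scale_def algebra_simps split: sum.split prod.split)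
    show "\<phi> i (b j) = (if i = j then 1 else 0)" if "i \<in> I" "j \<in> I" for i j
      using that by (auto simp: I_def \<phi>_def b_def R_def C_def le2 block_matrix_def dual_idem_eq)
    show "b i \<in> T" for i
      by (auto simp: b_def block_matrix_in_T dual_idem_eq split: sum.split prod.split)
    show "v = (\<Sum>i\<in>I. mat_scale (\<phi> i v) (b i))" if "v \<in> T" for v
    proof -
      from that obtain c a where v: "v = block_matrix g c a" by (auto simp: T_eq)
      have "(\<Sum>i\<in>I. mat_scale (\<phi> i v) (b i)) =
          (\<Sum>i\<le>2. \<Sum>j\<le>2. mat_scale (\<phi> (Inl (i, j)) v) (b (Inl (i, j)))) +
          (\<Sum>k\<in>{1, 2}. mat_scale (\<phi> (Inr k) v) (b (Inr k)))"
        by (simp add: I_def sum.Plus sum.cartesian_product case_prod_beta)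
      also have "\<dots> = block_matrix g (\<lambda>i j. v $ R i $ C j) (\<lambda>k. if k = 0 then 0 else v $ R k $ R k - v $ R k $ C k)"
        by (subst block_matrix_expand) (simp add: atMost2 b_def \<phi>_def mat_scale_def[of 0] zero_vec_def)
      also have "\<dots> = v"
      proof -
        \<comment> \<open>The representatives \<open>R i\<close> and \<open>C j\<close> differ
          unless i = j = 0, so the diagonal term is invisible in this entry except at x, where it is
          absorbed into the block coefficient.\<close>
        have 1: "v $ R i $ C j = c i j + (if i = 0 \<and> j = 0 then a 0 else 0)" if "i \<le> 2" "j \<le> 2" for i j
          using that unfolding le2 by (auto simp: v block_matrix_def R_def C_def)
        have 2: "v $ R k $ R k = c k k + a k" if "k \<le> 2" for k
          using that unfolding le2 by (auto simp: v block_matrix_def R_def)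
        have 3: "g y = 0 \<longleftrightarrow> y = x" for y
          using all_vertices[of "\<lambda>y. g y = 0 \<longleftrightarrow> y = x"] by simp
        have "block_matrix g (\<lambda>i j. v $ R i $ C j)
            (\<lambda>k. if k = 0 then 0 else v $ R k $ R k - v $ R k $ C k) $ y $ z = v $ y $ z" for y z
        proof -
          have "v $ y $ z = c (g y) (g z) + (if y = z then a (g y) else 0)"
            by (simp add: v block_matrix_def)
          then show ?thesis
            using 3[of y] 3[of z] by (cases "y = z"; cases "g y = 0") (simp_all add: block_matrix_def 1 2)
        qed
        then show ?thesis by (simp add: vec_eq_iff)
      qed
      finally show ?thesis by simp
    qed
  qed
  also have "card I = 11" by (simp add: I_def card_Plus card_cartesian_product)
  finally show ?thesis by (simp add: matrix_space_dim_def)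
qed

section \<open>The module of radial vectors\<close>

abbreviation radial :: "(nat \<Rightarrow> complex) \<Rightarrow> complex^'v" where
  "radial f \<equiv> \<chi> y. f (g y)"

abbreviation e :: "nat \<Rightarrow> complex^'v" where "e \<equiv> dual_vec E x"

abbreviation W0 :: "(complex^'v) set" where "W0 \<equiv> vec.span {e 0, e 1, e 2}"

definition seed :: "nat \<Rightarrow> complex^'v \<Rightarrow> bool" where
  "seed k v \<longleftrightarrow> (\<forall>y. g y \<noteq> k \<longrightarrow> v $ y = 0) \<and> (\<Sum>y\<in>UNIV. v $ y) = 0"

lemma e_component: "e i $ y = (if g y = i then 1 else 0)"
  by (simp add: dual_vec_def g_def)

lemma vec_eqI:
  fixes u v :: "complex^'v"
  assumes "u $ x = v $ x" "u $ p = v $ p" "u $ p' = v $ p'" "u $ q = v $ q" "u $ q' = v $ q'" "u $ q'' = v $ q''"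
  shows "u = v"
  unfolding vec_eq_iff all_vertices using assms by simp

text \<open>With vectors encoded by functions of the distance, the action of T becomes an explicit
  formula in f.\<close>

lemma W0_eq: "W0 = range radial"
proof
  have "vec.subspace (range radial)"
  proof (rule vec.subspaceI)
    show "0 \<in> range radial" by (rule range_eqI[of _ _ "\<lambda>_. 0"]) (simp add: vec_eq_iff)
    show "u + v \<in> range radial" if "u \<in> range radial" "v \<in> range radial" for u v
    proof -
      from that obtain f f' where "u = radial f" "v = radial f'" by blast
      then show ?thesis by (intro range_eqI[of _ _ "\<lambda>i. f i + f' i"]) (simp add: vec_eq_iff)
    qed
    show "c *s u \<in> range radial" if "u \<in> range radial" for c u
    proof -
      from that obtain f where "u = radial f" by blast
      then show ?thesis by (intro range_eqI[of _ _ "\<lambda>i. c * f i"]) (simp add: vec_eq_iff)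
    qed
  qed
  moreover have "e i \<in> range radial" for i
    by (rule range_eqI[of _ _ "\<lambda>j. if j = i then 1 else 0"]) (simp add: vec_eq_iff e_component)
  ultimately show "W0 \<subseteq> range radial"
    by (intro vec.span_minimal) auto
  have "radial f \<in> W0" for f
  proof -
    have "radial f = f 0 *s e 0 + f 1 *s e 1 + f 2 *s e 2"
      by (rule vec_eqI) (simp_all add: e_component)
    moreover have "f 0 *s e 0 + f 1 *s e 1 + f 2 *s e 2 \<in> W0"
      by (intro vec.span_add vec.span_scale vec.span_base) auto
    ultimately show ?thesis by simp
  qed
  then show "range radial \<subseteq> W0" by auto
qed

text \<open>The weights 1, 3, 2 are the sizes of the distance classes over which a block sums
  f.\<close>

lemma T_radial:
  "block_matrix g c a *v radial f =
    radial (\<lambda>i. (c i 0 * f 0 + 3 * (c i 1 * f 1) + 2 * (c i 2 * f 2)) + a i * f i)"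
  by (rule vec_eqI)
    (simp_all add: block_matrix_def matrix_vector_mult_def sum_vertices algebra_simps)

lemma is_module_W0: "is_module T W0"
  unfolding is_module_def W0_eq[symmetric]
proof (intro conjI ballI vec.subspace_span)
  fix B w assume "B \<in> T" "w \<in> W0"
  then obtain c a f where "B = block_matrix g c a" "w = radial f"
    unfolding T_eq W0_eq by blast
  then show "B *v w \<in> W0" unfolding W0_eq by (simp add: T_radial)
qed

lemma W0_subset:
  assumes U: "is_module T U" and "e 0 \<in> U"
  shows "W0 \<subseteq> U"
proof -
  have e: "e i = Js i 0 *v e 0" if "i \<le> 2" for i
    by (rule vec_eqI) (simp_all add: e_component block_matrix_def matrix_vector_mult_def sum_vertices)
  have "e i \<in> U" if "i \<le> 2" for i
    unfolding e[OF that] using assms block_matrix_in_T by (intro is_module_mult[of T U])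
  then show ?thesis
    using U by (intro vec.span_minimal) (auto simp: is_module_def)
qed

text \<open>A nonzero radial vector is nonzero on some class i, and \<open>Js 0 i\<close> collects
  that class into a nonzero multiple of \<open>e 0\<close>, which generates all of
  \<open>W0\<close>.\<close>

lemma irreducible_W0: "irreducible_module T W0"
proof -
  have "W0 \<subseteq> U" if U: "is_module T U" "U \<noteq> {0}" "U \<subseteq> W0" for U
  proof (rule W0_subset[OF U(1)])
    have sub: "vec.subspace U" using U(1) by (simp add: is_module_def)
    then obtain u where u: "u \<in> U" "u \<noteq> 0" using U(2) vec.subspace_0 by blast
    then obtain f where f: "u = radial f" using U(3) W0_eq by auto
    then obtain i where i: "i \<le> 2" "f i \<noteq> 0"
      using u(2) g_le_2 by (auto simp: vec_eq_iff simp del: g_le_2)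
    \<comment> \<open>The size of \<Gamma>_i(x), produced by summing a constant over that
      class.\<close>
    define n :: complex where "n = [1, 3, 2] ! i"
    have i': "i = 0 \<or> i = 1 \<or> i = 2" using i(1) by auto
    have "Js 0 i *v u = (n * f i) *s e 0"
      unfolding f T_radial using i'
      by (elim disjE) (simp_all add: n_def vec_eq_iff e_component)
    then have "inverse (n * f i) *s (Js 0 i *v u) = e 0"
      using i(2) i' by (auto simp: n_def)
    moreover have "Js 0 i *v u \<in> U" using U(1) block_matrix_in_T u(1) by (rule is_module_mult)
    ultimately show "e 0 \<in> U" using sub by (metis vec.subspace_scale)
  qed
  moreover have "e 0 \<in> W0" by (intro vec.span_base) simp
  then have "W0 \<noteq> {0}"
    using e_component[of 0 x] by (metis g_simps(1) singletonD zero_index zero_neq_one)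
  ultimately show ?thesis
    using is_module_W0 unfolding irreducible_module_def by blast
qed

lemma basis_W0: "distinct [e 0, e 1, e 2]" "vec.independent {e 0, e 1, e 2}" "vec.dim W0 = 3"
proof -
  let ?I = "{0, 1, 2 :: nat}"
  note df = vec.dual_family[of ?I "\<lambda>i v. v $ ([x, q, p] ! i)" e]
  have inj: "inj_on e ?I" and ind: "vec.independent (e ` ?I)"
    by (rule df; auto simp: e_component)+
  show d: "distinct [e 0, e 1, e 2]" using inj by (auto simp: inj_on_def)
  show i: "vec.independent {e 0, e 1, e 2}" using ind by simp
  have "card {e 0, e 1, e 2} = 3" using d by simp
  then show "vec.dim W0 = 3" using vec.dim_span_eq_card_independent[OF i] by simp
qed

section \<open>Seeds, their lines and multiplicities\<close>

lemma T_seed: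
  assumes "seed k v"
  shows "block_matrix g c a *v v = a k *s v"
proof -
  have "(\<Sum>z\<in>UNIV. (c (g y) (g z) + (if y = z then a (g y) else 0)) * v $ z) = a k * v $ y" for y
  proof -
    have "(\<Sum>z\<in>UNIV. (c (g y) (g z) + (if y = z then a (g y) else 0)) * v $ z) =
        (\<Sum>z\<in>UNIV. c (g y) k * v $ z + (if y = z then a k * v $ y else 0))"
      using assms by (intro sum.cong) (auto simp: seed_def algebra_simps)
    also have "\<dots> = c (g y) k * (\<Sum>z\<in>UNIV. v $ z) + a k * v $ y"
      by (simp add: sum.distrib sum_distrib_left)
    finally show ?thesis using assms by (simp add: seed_def)
  qed
  then show ?thesis
    by (simp add: vec_eq_iff matrix_vector_mult_def block_matrix_def)
qed

text \<open>The order of the quantifiers matters: a single scalar serves all seeds with the same k,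
  which is what makes their lines isomorphic.\<close>

lemma T_seed_ex: "B \<in> T \<Longrightarrow> \<exists>c. \<forall>v. seed k v \<longrightarrow> B *v v = c *s v"
  unfolding T_eq using T_seed by blast

lemma seed_irreducible: "seed k v \<Longrightarrow> v \<noteq> 0 \<Longrightarrow> irreducible_module T (vec.span {v})"
  by (rule line_irreducible) (use T_seed_ex[where k = k] in blast)+

lemma seeds_isomorphic:
  "seed k v \<Longrightarrow> v \<noteq> 0 \<Longrightarrow> seed k w \<Longrightarrow> w \<noteq> 0 \<Longrightarrow>
    module_isomorphic T (vec.span {v}) (vec.span {w})"
  by (rule lines_isomorphic) (use T_seed_ex[where k = k] in blast)+

text \<open>For \<open>k = 1, 2\<close> this is the orthogonal projection onto the sum-zero vectors on \<open>\<Gamma>\<^sub>k(x)\<close>;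
  \<open>[1, 3, 2] ! k\<close> is the size of \<open>\<Gamma>\<^sub>k(x)\<close>.\<close>

definition proj :: "nat \<Rightarrow> complex^'v^'v" where
  "proj k = block_matrix g (\<lambda>i j. if i = k \<and> j = k then - (1 / [1, 3, 2] ! k) else 0)
     (\<lambda>i. if i = k then 1 else 0)"

lemma proj_seed: "seed k v \<Longrightarrow> proj k *v v = v"
  unfolding proj_def by (simp add: T_seed[of k v])

lemma seed_proj:
  assumes k: "k = 1 \<or> k = 2"
  shows "seed k (proj k *v v)"
proof -
  \<comment> \<open>The mean of v over \<Gamma>_k(x); the projection restricts v to that class and
    subtracts the mean.\<close>
  define s where "s = (\<Sum>z\<in>UNIV. if g z = k then v $ z else 0) / [1, 3, 2] ! k"
  have "(proj k *v v) $ y = (if g y = k then v $ y - s else 0)" for y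
  proof -
    have "(proj k *v v) $ y = (\<Sum>z\<in>UNIV. (if g y = k then - (if g z = k then v $ z else 0) / [1, 3, 2] ! k else 0) +
        (if y = z then if g y = k then v $ y else 0 else 0))"
      unfolding proj_def block_matrix_def matrix_vector_mult_def vec_lambda_beta
      by (intro sum.cong) (auto simp: field_simps)
    also have "\<dots> = (if g y = k then v $ y - s else 0)"
      by (simp add: sum.distrib s_def sum_divide_distrib sum_negf)
    finally show ?thesis .
  qed
  then show ?thesis
    using k by (auto simp: seed_def sum_vertices s_def field_simps)
qed

lemma range_proj: "k = 1 \<or> k = 2 \<Longrightarrow> range ((*v) (proj k)) = {v. seed k v}"
proof (intro equalityI subsetI)
  show "v \<in> range ((*v) (proj k))" if "v \<in> {v. seed k v}" for v
    using that proj_seed[of k v] by (intro range_eqI[of _ _ v]) simp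
qed (use seed_proj in blast)

text \<open>If \<open>proj k\<close> does not annihilate an irreducible W', it sends some vector of
  W' to a nonzero seed, whose line must be all of W'. Hence W' is isomorphic to the given line and
  is fixed by \<open>proj k\<close>, with image of dimension 1.\<close>

lemma multiplicity_seed:
  assumes dec: "orthogonal_decomposition T Ws" and W: "vec.span {v} \<in> set Ws"
    and k: "k = 1 \<or> k = 2" and v: "seed k v" "v \<noteq> 0"
  shows "multiplicity T (vec.span {v}) = vec.dim {v. seed k v}"
  unfolding range_proj[OF k, symmetric]
proof (rule multiplicity_eq_rank[OF dec W])
  show "proj k \<in> T" unfolding proj_def by (rule block_matrix_in_T)
  have im: "(*v) (proj k) ` vec.span {u} = vec.span {u}" if "seed k u" for u
    by (simp add: vec.span_image[symmetric] proj_seed that)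
  show "(*v) (proj k) ` vec.span {v} \<noteq> {0}"
    unfolding im[OF v(1)] using v(2) vec.span_base[of v "{v}"] by auto
  fix W' assume irr: "irreducible_module T W'" and ne: "(*v) (proj k) ` W' \<noteq> {0}"
  have W': "is_module T W'" using irr by (simp add: irreducible_module_def)
  then have "0 \<in> W'" by (simp add: is_module_def vec.subspace_0)
  then obtain w where w: "w \<in> W'" "proj k *v w \<noteq> 0"
    using ne by force
  define u where "u = proj k *v w"
  have u: "seed k u" "u \<noteq> 0" using seed_proj[OF k] w(2) by (simp_all add: u_def)
  have "u \<in> W'" unfolding u_def
    using W' w(1) by (intro is_module_mult[OF W']) (simp_all add: proj_def block_matrix_in_T)
  then have "vec.span {u} \<subseteq> W'"
    using W' by (intro vec.span_minimal) (simp_all add: is_module_def)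
  then have "vec.span {u} = W'"
    using seed_irreducible[OF u] irreducible_moduleD[OF irr, of "vec.span {u}"]
    unfolding irreducible_module_def by blast
  then show "module_isomorphic T (vec.span {v}) W' \<and> vec.dim ((*v) (proj k) ` W') = 1"
    using im[OF u(1)] seeds_isomorphic[OF v u] u(2) by auto
qed

lemma dual_idem_mult: "(dual_idem E x i *v v) $ y = (if g y = i then v $ y else 0)"
proof -
  have "(\<Sum>z\<in>UNIV. (if y = z \<and> g y = i then 1 else 0) * v $ z) =
      (\<Sum>z\<in>UNIV. if y = z then if g y = i then v $ y else 0 else 0)"
    by (intro sum.cong) auto
  then show ?thesis
    by (simp add: dual_idem_def matrix_vector_mult_def flip: g_def)
qed

lemma dual_idem_e: "dual_idem E x i *v e j = (if i = j then e j else 0)"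
  by (auto simp: vec_eq_iff dual_idem_mult e_component)

lemma dual_idem_seed: "seed k v \<Longrightarrow> dual_idem E x i *v v = (if i = k then v else 0)"
  by (auto simp: vec_eq_iff dual_idem_mult seed_def)

lemma dual_idem_in_T: "dual_idem E x i \<in> T"
  unfolding dual_idem_eq by (rule block_matrix_in_T)

text \<open>The matrix \<open>dual_idem E x 0\<close> has rank one with image spanned by
  \<open>e 0\<close>. An irreducible module it does not annihilate contains \<open>e 0\<close>,
  hence contains \<open>W0\<close>, and so equals \<open>W0\<close>.\<close>

lemma multiplicity_W0:
  assumes dec: "orthogonal_decomposition T Ws" and W: "W0 \<in> set Ws"
  shows "multiplicity T W0 = 1"
proof -
  have e0: "e 0 \<noteq> 0" by (auto simp: vec_eq_iff e_component intro: exI[of _ x])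
  have g0: "g y = 0 \<longleftrightarrow> y = x" for y
    using all_vertices[of "\<lambda>y. g y = 0 \<longleftrightarrow> y = x"] by simp
  have E0: "dual_idem E x 0 *v w = (w $ x) *s e 0" for w
    by (simp add: vec_eq_iff dual_idem_mult e_component g0)
  \<comment> \<open>Applied to \<open>W0\<close>, to an arbitrary irreducible module containing
    \<open>e 0\<close>, and to the whole space, where it gives the rank.\<close>
  have im: "(*v) (dual_idem E x 0) ` U = vec.span {e 0}" if "vec.subspace U" "e 0 \<in> U" for U
    using that by (auto simp: E0 vec.span_singleton image_iff e_component vec.subspace_scale
        intro!: bexI[of _ "_ *s e 0"])
  have "multiplicity T W0 = vec.dim (range ((*v) (dual_idem E x 0)))"
  proof (rule multiplicity_eq_rank[OF dec W dual_idem_in_T])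
    show "(*v) (dual_idem E x 0) ` W0 \<noteq> {0}"
      using im[of W0] e0 vec.span_base[of "e 0" "{e 0}"] vec.span_base[of "e 0" "{e 0, e 1, e 2}"]
      by auto
    fix W' assume irr: "irreducible_module T W'" and ne: "(*v) (dual_idem E x 0) ` W' \<noteq> {0}"
    have W': "is_module T W'" using irr by (simp add: irreducible_module_def)
    then have sub: "vec.subspace W'" by (simp add: is_module_def)
    obtain w where w: "w \<in> W'" "dual_idem E x 0 *v w \<noteq> 0"
      using ne vec.subspace_0[OF sub] by force
    then have "(w $ x) *s e 0 \<in> W'" "w $ x \<noteq> 0"
      using is_module_mult[OF W' dual_idem_in_T[of 0] w(1)] w(2) unfolding E0 by auto
    then have "inverse (w $ x) *s ((w $ x) *s e 0) \<in> W'"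
      using vec.subspace_scale[OF sub] by blast
    then have e0W: "e 0 \<in> W'" using \<open>w $ x \<noteq> 0\<close> by simp
    have "W0 \<noteq> {0}" using irreducible_W0 by (simp add: irreducible_module_def)
    then have "W0 = W'"
      using irreducible_moduleD[OF irr is_module_W0] W0_subset[OF W' e0W] by blast
    then show "module_isomorphic T W0 W' \<and> vec.dim ((*v) (dual_idem E x 0) ` W') = 1"
      using module_isomorphic_refl im[OF sub e0W] e0 by simp
  qed
  also have "\<dots> = 1" using im[of UNIV] e0 by simp
  finally show ?thesis .
qed

lemma dim_seed_1: "vec.dim {v. seed 1 v} = 2"
proof -
  \<comment> \<open>The sum condition determines the coordinate at \<open>q''\<close>, so those at
    \<open>q\<close> and \<open>q'\<close> are free.\<close>
  have "vec.dim {v. seed 1 v} = card {q, q'}"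
    by (rule vec.dim_eq_card_dual_family[where \<phi> = "\<lambda>i v. v $ i" and b = "\<lambda>i. axis i 1 - axis q'' 1"])
      (auto simp: seed_def all_vertices sum_vertices axis_def add_eq_0_iff add_eq_0_iff2 algebra_simps intro!: vec_eqI)
  then show ?thesis by simp
qed

lemma dim_seed_2: "vec.dim {v. seed 2 v} = 1"
proof -
  have "vec.dim {v. seed 2 v} = card {p}"
    by (rule vec.dim_eq_card_dual_family[where \<phi> = "\<lambda>i v. v $ i" and b = "\<lambda>i. axis i 1 - axis p' 1"])
      (auto simp: seed_def all_vertices sum_vertices axis_def add_eq_0_iff intro!: vec_eqI)
  then show ?thesis by simp
qed

section \<open>The spectrum of the adjacency matrix\<close>

lemma spectrum: "spectrum_mult (adj_matrix E) = {(3, 1), (0, 4), (-3, 1)}"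
proof -
  let ?S = "eigenspace (adj_matrix E)"
  have mem: "v \<in> ?S \<theta> \<longleftrightarrow>
      v $ q + v $ q' + v $ q'' = \<theta> * v $ x \<and> v $ q + v $ q' + v $ q'' = \<theta> * v $ p \<and>
      v $ q + v $ q' + v $ q'' = \<theta> * v $ p' \<and> v $ x + v $ p + v $ p' = \<theta> * v $ q \<and>
      v $ x + v $ p + v $ p' = \<theta> * v $ q' \<and> v $ x + v $ p + v $ p' = \<theta> * v $ q''" for v \<theta>
    by (simp add: eigenspace_def vec_eq_iff all_vertices matrix_vector_mult_def sum_vertices
        adj_matrix_eq block_matrix_def add.assoc)
  \<comment> \<open>For a nonzero eigenvalue, vertices with the same neighbours have equal
    coordinates, so v is constant on each side and only a 2 x 2 system remains.\<close>
  have eqs: "v $ p = v $ x \<and> v $ p' = v $ x \<and> v $ q' = v $ q \<and> v $ q'' = v $ q \<and>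
      3 * v $ q = \<theta> * v $ x \<and> 3 * v $ x = \<theta> * v $ q" if "v \<in> ?S \<theta>" "\<theta> \<noteq> 0" for v \<theta>
  proof -
    note v = that(1)[unfolded mem]
    have "v $ p = v $ x" "v $ p' = v $ x" "v $ q' = v $ q" "v $ q'' = v $ q"
      using v \<open>\<theta> \<noteq> 0\<close> by (metis mult_cancel_left)+
    then show ?thesis using v by simp
  qed
  \<comment> \<open>Eliminating \<open>v $ q\<close> from the 2 x 2 system leaves the condition that
    \<theta> squared is 9, unless v = 0.\<close>
  have trivial: "?S \<theta> = {0}" if \<theta>: "\<theta> \<noteq> 0" "\<theta> \<noteq> 3" "\<theta> \<noteq> -3" for \<theta>
  proof -
    have "v = 0" if "v \<in> ?S \<theta>" for v
    proof -
      note v = eqs[OF that \<theta>(1)]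
      have "\<theta> * (\<theta> * v $ x) = 3 * (\<theta> * v $ q)"
        using v by (metis mult.left_commute)
      also have "\<dots> = 9 * v $ x" using v by (simp flip: v)
      finally have "(\<theta> - 3) * (\<theta> + 3) * v $ x = 0" by (simp add: algebra_simps)
      then have "v $ x = 0" using \<theta> by (auto simp: add_eq_0_iff2)
      then show ?thesis using v by (intro vec_eqI) auto
    qed
    moreover have "0 \<in> ?S \<theta>" by (simp add: mem)
    ultimately show ?thesis by blast
  qed
  have dim3: "vec.dim (?S 3) = card {x}"
  proof (rule vec.dim_eq_card_dual_family[where \<phi> = "\<lambda>i v. v $ i" and b = "\<lambda>_. 1"])
    show "v = (\<Sum>i\<in>{x}. v $ i *s 1)" if "v \<in> ?S 3" for v
    proof -
      have "3 * v $ q = 3 * v $ x" "v $ p = v $ x" "v $ p' = v $ x" "v $ q' = v $ q" "v $ q'' = v $ q"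
        using eqs[OF that zero_neq_numeral[symmetric]] by blast+
      moreover from this(1) have "v $ q = v $ x" by simp
      ultimately show ?thesis by (intro vec_eqI) simp_all
    qed
  qed (simp_all add: mem)
  \<comment> \<open>The eigenvector is 1 on the side of x and -1 on the other side.\<close>
  have dimm3: "vec.dim (?S (-3)) = card {x}"
  proof (rule vec.dim_eq_card_dual_family[where \<phi> = "\<lambda>i v. v $ i"
        and b = "\<lambda>_. radial (\<lambda>i. if i = 1 then -1 else 1)"])
    show "v = (\<Sum>i\<in>{x}. v $ i *s radial (\<lambda>i. if i = 1 then -1 else 1))" if "v \<in> ?S (-3)" for v
    proof -
      have "3 * v $ q = -3 * v $ x" "v $ p = v $ x" "v $ p' = v $ x" "v $ q' = v $ q" "v $ q'' = v $ q"
        using eqs[OF that] by (simp_all only: neg_equal_0_iff_equal zero_neq_numeral[symmetric] not_False_eq_True simp_thms)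
      moreover from this(1) have "3 * v $ q = 3 * (- v $ x)" by simp
      then have "v $ q = - v $ x" by (subst (asm) mult_cancel_left) simp
      ultimately show ?thesis by (intro vec_eqI) simp_all
    qed
  qed (simp_all add: mem)
  \<comment> \<open>The kernel consists of the vectors with coordinate sum 0 on each side, giving 2
    + 2 dimensions. The dependent coordinate is taken at x on one side and at \<open>q''\<close> on
    the other.\<close>
  have dim0: "vec.dim (?S 0) = card {p, p', q, q'}"
  proof (rule vec.dim_eq_card_dual_family[where \<phi> = "\<lambda>i v. v $ i"
        and b = "\<lambda>i. axis i 1 - axis (if g i = 1 then q'' else x) 1"])
    show "v = (\<Sum>i\<in>{p, p', q, q'}. v $ i *s (axis i 1 - axis (if g i = 1 then q'' else x) 1))"
      if "v \<in> ?S 0" for v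
    proof -
      have "v $ x + v $ p + v $ p' = 0" "v $ q + v $ q' + v $ q'' = 0"
        using that by (simp_all add: mem)
      moreover have "a = - b - c" "c = - a - b" if "a + b + c = 0" for a b c :: complex
        using that by (simp_all add: eq_diff_eq eq_neg_iff_add_eq_0 add_ac)
      ultimately have "v $ x = - v $ p - v $ p'" "v $ q'' = - v $ q - v $ q'" by blast+
      then show ?thesis by (intro vec_eqI) (simp_all add: axis_def)
    qed
  qed (auto simp: mem axis_def)
  have dims: "vec.dim (?S 3) = 1" "vec.dim (?S (-3)) = 1" "vec.dim (?S 0) = 4"
    using dim3 dimm3 dim0 by simp_all
  then have ne: "?S 3 \<noteq> {0}" "?S (-3) \<noteq> {0}" "?S 0 \<noteq> {0}"
    by (metis vec.dim_singleton zero_neq_one zero_neq_numeral)+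
  show ?thesis
  proof (rule Set.set_eqI)
    fix \<theta>m :: "complex \<times> nat"
    obtain \<theta> m where \<theta>m: "\<theta>m = (\<theta>, m)" by (cases \<theta>m)
    show "\<theta>m \<in> spectrum_mult (adj_matrix E) \<longleftrightarrow> \<theta>m \<in> {(3, 1), (0, 4), (-3, 1)}"
      unfolding \<theta>m spectrum_mult_def using trivial[of \<theta>] dims ne by auto
  qed
qed

section \<open>Endpoints, shapes and bases of the modules\<close>

lemma subconstituent_span: "subconstituent E x i (vec.span S) = vec.span ((*v) (dual_idem E x i) ` S)"
  unfolding subconstituent_def by (rule vec.span_image[symmetric])

lemma subconstituent_W0: "i \<le> 2 \<Longrightarrow> subconstituent E x i W0 = vec.span {e i}"
proof -
  assume "i \<le> 2"
  then have "i = 0 \<or> i = 1 \<or> i = 2" by auto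
  \<comment> \<open>The other basis vectors are sent to 0, which does not change a span; hence the
    comparison modulo 0.\<close>
  then have "(*v) (dual_idem E x i) ` {e 0, e 1, e 2} - {0} = {e i} - {0}"
    by (auto simp: dual_idem_e)
  then show ?thesis
    unfolding subconstituent_span by (metis vec.span_delete_0)
qed

lemma subconstituent_seed:
  "seed k v \<Longrightarrow> subconstituent E x i (vec.span {v}) = (if i = k then vec.span {v} else {0})"
  by (simp add: subconstituent_span dual_idem_seed)

lemma e_nonzero: "i \<le> 2 \<Longrightarrow> e i \<noteq> 0"
proof -
  assume "i \<le> 2"
  then have "i = 0 \<or> i = 1 \<or> i = 2" by auto
  then have "e i $ ([x, q, p] ! i) = 1" by (auto simp: e_component)
  then show ?thesis by (metis zero_index zero_neq_one)
qed

lemma span_nonzero: "v \<noteq> 0 \<Longrightarrow> vec.span {v} \<noteq> {0}" for v :: "complex^'v"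
  using vec.span_base[of v "{v}"] by auto

lemma pure_e: "i \<le> 2 \<Longrightarrow> pure E x i (e i)"
  unfolding pure_def subconstituent_def using e_nonzero[of i] dual_idem_e[of i i]
  by (metis rangeI)

lemma pure_seed: "seed k v \<Longrightarrow> v \<noteq> 0 \<Longrightarrow> pure E x k v"
  unfolding pure_def subconstituent_def using dual_idem_seed[of k v k] by (metis rangeI)

lemma has_data_W0:
  assumes "orthogonal_decomposition T Ws" and "W0 \<in> set Ws"
  shows "has_data E x W0 0 1 3 2 [1, 1, 1] [e 0, e 1, e 2]
    (mat_of_rows_list 3 [[0, 3, 0], [1, 0, 2], [0, 3, 0]])"
proof -
  have "{i. i \<le> 2 \<and> subconstituent E x i W0 \<noteq> {0}} = {0, 1, 2}"
    using subconstituent_W0 span_nonzero[OF e_nonzero] by auto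
  then have "endpoint E x W0 = 0" and diam: "module_diameter E x W0 = 2"
    unfolding endpoint_def module_diameter_def diameter by simp_all
  moreover have "[0..<0 + 2 + 1] = [0, 1, 2 :: nat]" by (simp add: upt_rec)
  then have "module_shape E x W0 = [1, 1, 1]"
    unfolding module_shape_def \<open>endpoint E x W0 = 0\<close> diam
    by (simp add: subconstituent_W0 e_nonzero del: One_nat_def)
  moreover have "pure_basis E x W0 [e 0, e 1, e 2]"
    unfolding pure_basis_def
  proof (intro conjI exI[of _ "[0, 1, 2]"])
    show "\<forall>k<length [e 0, e 1, e 2]. pure E x ([0, 1, 2] ! k) ([e 0, e 1, e 2] ! k)"
      by (auto simp: less_Suc_eq pure_e nth_Cons split: nat.split)
  qed (use basis_W0 in auto)
  moreover have "represents (adj_matrix E) [e 0, e 1, e 2]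
    (mat_of_rows_list 3 [[0, 3, 0], [1, 0, 2], [0, 3, 0]])"
  proof -
    \<comment> \<open>The coefficients count neighbours in the given class, and each equation is one
      column of the representing matrix.\<close>
    have "adj_matrix E *v e 0 = e 1" "adj_matrix E *v e 1 = 3 *s e 0 + 3 *s e 2"
      "adj_matrix E *v e 2 = 2 *s e 1"
      by (rule vec_eqI; simp add: e_component adj_matrix_eq block_matrix_def
          matrix_vector_mult_def sum_vertices)+
    then show ?thesis
      unfolding represents_def
      by (auto simp: mat_of_rows_list_def less_Suc_eq numeral_3_eq_3 numeral_2_eq_2)
  qed
  ultimately show ?thesis
    using multiplicity_W0[OF assms] basis_W0(3) by (simp add: has_data_def)
qed

lemma adj_matrix_seed: "seed k v \<Longrightarrow> adj_matrix E *v v = 0"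
  unfolding adj_matrix_eq by (simp add: T_seed)

lemma
  assumes v: "seed k v" "v \<noteq> 0" and k: "k \<le> 2"
  shows endpoint_seed: "endpoint E x (vec.span {v}) = k"
    and module_diameter_seed: "module_diameter E x (vec.span {v}) = 0"
proof -
  have "{i. i \<le> 2 \<and> subconstituent E x i (vec.span {v}) \<noteq> {0}} = {k}"
    using k subconstituent_seed[OF v(1)] span_nonzero[OF v(2)] by (auto split: if_splits)
  then show "endpoint E x (vec.span {v}) = k" "module_diameter E x (vec.span {v}) = 0"
    unfolding endpoint_def module_diameter_def diameter by simp_all
qed

lemma has_data_seed:
  assumes v: "seed k v" "v \<noteq> 0" and k: "k = 1 \<or> k = 2"
    and "orthogonal_decomposition T Ws" and "vec.span {v} \<in> set Ws"
  shows "has_data E x (vec.span {v}) k (vec.dim {v. seed k v}) 1 0 [1] [v]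
    (mat_of_rows_list 1 [[0]])"
proof -
  have "k \<le> 2" using k by auto
  note ed = endpoint_seed[OF v this] module_diameter_seed[OF v this]
  have "module_shape E x (vec.span {v}) = [1]"
    unfolding module_shape_def ed by (simp add: subconstituent_seed[OF v(1)] v(2))
  moreover have "pure_basis E x (vec.span {v}) [v]"
    unfolding pure_basis_def using v pure_seed[OF v] by (intro conjI exI[of _ "[k]"]) simp_all
  moreover have "represents (adj_matrix E) [v] (mat_of_rows_list 1 [[0]])"
    unfolding represents_def by (simp add: mat_of_rows_list_def adj_matrix_seed[OF v(1)])
  ultimately show ?thesis
    using multiplicity_seed[OF assms(4,5) k v] v(2) ed by (simp add: has_data_def)
qed

lemma is_seed_seed:
  assumes v: "seed k v" "v \<noteq> 0" and k: "k = 1 \<or> k = 2" and "essential_part ws v = cs"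
  shows "is_seed E x (vec.span {v}) ws v cs"
proof -
  have "k \<le> 2" using k by auto
  then show ?thesis
    using assms pure_seed[OF v] subconstituent_seed[OF v(1), of k]
    by (simp add: is_seed_def endpoint_seed[OF v])
qed

text \<open>The dual idempotents lie in T, so the set of distances on which a module lives is an
  isomorphism invariant.\<close>

lemma not_isomorphic:
  assumes irr: "irreducible_module T W" "irreducible_module T W'"
    and k: "\<And>i. i \<le> 2 \<Longrightarrow> subconstituent E x i W \<noteq> {0} \<longleftrightarrow> i \<in> S"
    and k': "\<And>i. i \<le> 2 \<Longrightarrow> subconstituent E x i W' \<noteq> {0} \<longleftrightarrow> i \<in> S'"
    and "i \<le> 2" "i \<in> S \<longleftrightarrow> i \<notin> S'"
  shows "\<not> module_isomorphic T W W'"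
  using isomorphic_image_zero[of T W W' "dual_idem E x i"] irr dual_idem_in_T[of i] k[of i] k'[of i] assms(5,6)
  unfolding subconstituent_def irreducible_module_def by blast

section \<open>Explicit seeds and the decomposition\<close>

definition \<nu>a :: "complex^'v" where "\<nu>a = axis q 1 - axis q' 1"
text \<open>Up to scaling, the only seed at distance 1 orthogonal to \<open>\<nu>a\<close>.\<close>

definition \<nu>b :: "complex^'v" where "\<nu>b = axis q 1 + axis q' 1 - 2 *s axis q'' 1"
definition \<nu>2 :: "complex^'v" where "\<nu>2 = axis p 1 - axis p' 1"

lemma seeds: "seed 1 \<nu>a" "seed 1 \<nu>b" "seed 2 \<nu>2"
  by (simp_all add: seed_def all_vertices sum_vertices \<nu>a_def \<nu>b_def \<nu>2_def axis_def)

lemma seeds_nonzero: "\<nu>a \<noteq> 0" "\<nu>b \<noteq> 0" "\<nu>2 \<noteq> 0"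
  by (simp_all add: vec_eq_iff all_vertices \<nu>a_def \<nu>b_def \<nu>2_def axis_def)

text \<open>Orthogonality is checked on generators and passes to spans. The sum is then all of V by
  counting dimensions: 3 + 1 + 1 + 1 = 6.\<close>

lemma decomposition:
  "orthogonal_decomposition T [W0, vec.span {\<nu>a}, vec.span {\<nu>b}, vec.span {\<nu>2}]"
  (is "orthogonal_decomposition T ?Ws")
proof -
  let ?G = "[{e 0, e 1, e 2}, {\<nu>a}, {\<nu>b}, {\<nu>2}]"
  have G: "?Ws = map vec.span ?G" by simp
  have comp: "axis a c $ b = (if a = b then c else 0)" for a b :: 'v and c :: complex
    by (simp add: axis_def)
  have orth: "cinner u v = 0" if "i < j" "j < length ?G" "u \<in> ?G ! i" "v \<in> ?G ! j" for i j u v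
  proof -
    have "(i, j) \<in> {(0, 1), (0, 2), (0, 3), (1, 2), (1, 3), (2, 3)}"
      using that(1,2) by auto
    then show ?thesis
      using that(3,4)
      by (auto simp: cinner_def sum_vertices \<nu>a_def \<nu>b_def \<nu>2_def comp e_component)
  qed
  have orth': "cinner u v = 0" if "i < j" "j < length ?Ws" "u \<in> ?Ws ! i" "v \<in> ?Ws ! j" for i j u v
  proof (rule cinner_eq_0_span)
    have ij: "i < length ?G" "j < length ?G" using that(1,2) by simp_all
    show "u \<in> vec.span (?G ! i)" "v \<in> vec.span (?G ! j)"
      using that(3,4) unfolding G nth_map[OF ij(1)] nth_map[OF ij(2)] .
  qed (use that(1,2) orth in simp)
  have "vec.dim (vec.span (\<Union>(set ?Ws))) = (\<Sum>W\<leftarrow>?Ws. vec.dim W)"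
    by (rule dim_span_orthogonal_list[OF _ orth']) auto
  also have "\<dots> = 6" using basis_W0(3) seeds_nonzero by simp
  also have "6 = CARD('v)"
    using complete_bipartite_3_3_intersection_array(2)[OF bipartite] by simp
  finally have "vec.span (\<Union>(set ?Ws)) = UNIV"
    using vec.dim_eq_full[of "\<Union>(set ?Ws)"] by (simp add: vec.dimension_def card_cart_basis del: vec.span_Un)
  moreover have "\<forall>W\<in>set ?Ws. irreducible_module T W"
    using irreducible_W0 seed_irreducible[OF seeds(1) seeds_nonzero(1)]
      seed_irreducible[OF seeds(2) seeds_nonzero(2)] seed_irreducible[OF seeds(3) seeds_nonzero(3)]
    by simp
  moreover have "cinner u v = 0"
    if "i < length ?Ws" "j < length ?Ws" "i \<noteq> j" "u \<in> ?Ws ! i" "v \<in> ?Ws ! j" for i j u v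
    using that orth'[of i j u v] orth'[of j i v u] cinner_commute[of u v]
    by (metis complex_cnj_zero nat_neq_iff)
  ultimately show ?thesis
    unfolding orthogonal_decomposition_def by blast
qed

lemma isomorphic_iff_types:
  assumes "i < 4" and "j < 4"
  shows "module_isomorphic T ([W0, vec.span {\<nu>a}, vec.span {\<nu>b}, vec.span {\<nu>2}] ! i)
      ([W0, vec.span {\<nu>a}, vec.span {\<nu>b}, vec.span {\<nu>2}] ! j) \<longleftrightarrow>
    [1, 2, 2, 3 :: nat] ! i = [1, 2, 2, 3] ! j"
proof -
  let ?Ws = "[W0, vec.span {\<nu>a}, vec.span {\<nu>b}, vec.span {\<nu>2}]"
  let ?S = "[{0, 1, 2 :: nat}, {1}, {1}, {2}]"
  have less4: "k < 4 \<longleftrightarrow> k = 0 \<or> k = 1 \<or> k = 2 \<or> k = 3" for k :: nat by auto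
  have irr: "irreducible_module T (?Ws ! k)" if "k < 4" for k
    using decomposition that nth_mem[of k ?Ws] by (auto simp: orthogonal_decomposition_def)
  have supp: "subconstituent E x l (?Ws ! k) \<noteq> {0} \<longleftrightarrow> l \<in> ?S ! k" if "k < 4" "l \<le> 2" for k l
    using that subconstituent_W0[of l] e_nonzero[of l] seeds_nonzero
    by (auto simp: less4 subconstituent_seed[OF seeds(1)] subconstituent_seed[OF seeds(2)]
        subconstituent_seed[OF seeds(3)] span_nonzero)
  \<comment> \<open>Membership of the distances 0 and 1 already separates the supports {0, 1, 2},
    {1} and {2}.\<close>
  have "(0 \<in> ?S ! i \<longleftrightarrow> 0 \<notin> ?S ! j) \<or> (1 \<in> ?S ! i \<longleftrightarrow> 1 \<notin> ?S ! j)"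
    if "[1, 2, 2, 3 :: nat] ! i \<noteq> [1, 2, 2, 3] ! j"
    using that assms unfolding less4 by (elim disjE) simp_all
  then have "\<exists>l\<le>2. l \<in> ?S ! i \<longleftrightarrow> l \<notin> ?S ! j" if "[1, 2, 2, 3 :: nat] ! i \<noteq> [1, 2, 2, 3] ! j"
    using that by (metis one_le_numeral zero_le)
  then have "\<not> module_isomorphic T (?Ws ! i) (?Ws ! j)"
    if "[1, 2, 2, 3 :: nat] ! i \<noteq> [1, 2, 2, 3] ! j"
    using not_isomorphic[OF irr[OF assms(1)] irr[OF assms(2)] supp[OF assms(1)] supp[OF assms(2)]] that
    by blast
  moreover have "module_isomorphic T (?Ws ! i) (?Ws ! j)"
    if "[1, 2, 2, 3 :: nat] ! i = [1, 2, 2, 3] ! j"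
    using that assms unfolding less4
    by (elim disjE) (simp_all add: module_isomorphic_refl
        seeds_isomorphic[OF seeds(1) seeds_nonzero(1) seeds(2) seeds_nonzero(2)]
        seeds_isomorphic[OF seeds(2) seeds_nonzero(2) seeds(1) seeds_nonzero(1)])
  ultimately show ?thesis by blast
qed

end

section \<open>The theorem\<close>

text \<open>In coordinates, a nonzero eigenvalue forces a = c and then \<theta> squared to be 9.
  Conversely, (1, 1, 1), (2, 0, -1) and (1, -1, 1) are eigenvectors for 3, 0 and -3.\<close>

lemma eigenvalues_type_I:
  "{\<theta>. eigenvalue (mat_of_rows_list 3 [[0, 3, 0], [1, 0, 2], [0, 3, 0 :: complex]]) \<theta>} = {3, 0, -3}"
  (is "{\<theta>. eigenvalue ?B \<theta>} = _")
proof -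
  have B: "?B *\<^sub>v v = vec_of_list [3 * vec_index v 1, vec_index v 0 + 2 * vec_index v 2, 3 * vec_index v 1]"
    if "v \<in> carrier_vec 3" for v
    using that
    by (intro eq_vecI) (auto simp: mat_of_rows_list_def scalar_prod_def less_Suc_eq numeral_3_eq_3
        numeral_2_eq_2)
  have dim: "dim_row ?B = 3" by (simp add: mat_of_rows_list_def)
  have vec3: "v = w \<longleftrightarrow> vec_index v 0 = vec_index w 0 \<and> vec_index v 1 = vec_index w 1 \<and> vec_index v 2 = vec_index w 2"
    if "v \<in> carrier_vec 3" "w \<in> carrier_vec 3" for v w :: "complex Matrix.vec"
    using that by (auto intro!: eq_vecI simp: less_Suc_eq numeral_3_eq_3 numeral_2_eq_2)
  have ev: "eigenvalue ?B \<theta> \<longleftrightarrow> (\<exists>a b c. (a, b, c) \<noteq> (0, 0, 0) \<and> 3 * b = \<theta> * a \<and> a + 2 * c = \<theta> * b \<and> 3 * b = \<theta> * c)"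
    (is "_ \<longleftrightarrow> ?R") for \<theta>
  proof
    assume "eigenvalue ?B \<theta>"
    then obtain v where v: "v \<in> carrier_vec 3" "v \<noteq> 0\<^sub>v 3" "?B *\<^sub>v v = \<theta> \<cdot>\<^sub>v v"
      by (auto simp: eigenvalue_def eigenvector_def dim)
    have "vec_index (\<theta> \<cdot>\<^sub>v v) k =
        vec_index (vec_of_list [3 * vec_index v 1, vec_index v 0 + 2 * vec_index v 2, 3 * vec_index v 1]) k" for k
      by (simp only: B[OF v(1)] flip: v(3))
    from this[of 0] this[of 1] this[of 2] have "3 * vec_index v 1 = \<theta> * vec_index v 0"
      "vec_index v 0 + 2 * vec_index v 2 = \<theta> * vec_index v 1" "3 * vec_index v 1 = \<theta> * vec_index v 2"
      using v(1) by (simp_all add: numeral_2_eq_2)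
    moreover have "(vec_index v 0, vec_index v 1, vec_index v 2) \<noteq> (0, 0, 0)"
      using v(2) vec3[OF v(1) zero_carrier_vec] by auto
    ultimately show ?R by blast
  next
    assume ?R
    then obtain a b c where abc: "(a, b, c) \<noteq> (0, 0, 0)" "3 * b = \<theta> * a" "a + 2 * c = \<theta> * b" "3 * b = \<theta> * c"
      by blast
    have v: "vec_of_list [a, b, c] \<in> carrier_vec 3" by (rule carrier_vecI) simp
    have "?B *\<^sub>v vec_of_list [a, b, c] = \<theta> \<cdot>\<^sub>v vec_of_list [a, b, c]"
      unfolding B[OF v] using abc by (subst vec3) (auto intro: carrier_vecI simp: numeral_2_eq_2)
    moreover have "vec_of_list [a, b, c] \<noteq> 0\<^sub>v 3"
      using abc(1) v by (auto simp: vec3 numeral_2_eq_2)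
    ultimately show "eigenvalue ?B \<theta>"
      using v by (auto simp: eigenvalue_def eigenvector_def dim)
  qed
  show ?thesis
  proof (intro equalityI subsetI)
    fix \<theta> assume "\<theta> \<in> {\<theta>. eigenvalue ?B \<theta>}"
    then obtain a b c where abc: "(a, b, c) \<noteq> (0, 0, 0)" "3 * b = \<theta> * a" "a + 2 * c = \<theta> * b" "3 * b = \<theta> * c"
      unfolding ev mem_Collect_eq by blast
    show "\<theta> \<in> {3, 0, -3}"
    proof (rule ccontr)
      assume "\<theta> \<notin> {3, 0, -3}"
      then have \<theta>: "\<theta> \<noteq> 0" "\<theta> - 3 \<noteq> 0" "\<theta> + 3 \<noteq> 0" by (auto simp: add_eq_0_iff2)
      have ca: "c = a" using abc \<theta>(1) by (metis mult_cancel_left)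
      have "\<theta> * (\<theta> * b) = 3 * (\<theta> * a)" using abc(3) ca by (simp add: algebra_simps)
      also have "\<dots> = 9 * b" by (simp flip: abc(2))
      finally have "(\<theta> - 3) * ((\<theta> + 3) * b) = 0" by (simp add: algebra_simps)
      then have "b = 0" using \<theta> by simp
      then show False using abc(1,2) ca \<theta>(1) by auto
    qed
  next
    fix \<theta> :: complex assume "\<theta> \<in> {3, 0, -3}"
    then consider "\<theta> = 3" | "\<theta> = 0" | "\<theta> = -3" by blast
    then show "\<theta> \<in> {\<theta>. eigenvalue ?B \<theta>}"
    proof cases
      case 1
      then show ?thesis unfolding ev mem_Collect_eq by (intro exI[of _ 1]) simp
    next
      case 2
      then show ?thesis unfolding ev mem_Collect_eq
        by (intro exI[of _ 2] exI[of _ 0] exI[of _ "-1"]) simp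
    next
      case 3
      then show ?thesis unfolding ev mem_Collect_eq
        by (intro exI[of _ 1] exI[of _ "-1"] exI[of _ 1]) simp
    qed
  qed
qed

lemma eigenvalues_type_II: "{\<theta>. eigenvalue (mat_of_rows_list 1 [[0 :: complex]]) \<theta>} = {0}"
  (is "{\<theta>. eigenvalue ?B \<theta>} = _")
proof -
  have B: "?B = 0\<^sub>m 1 1" by (auto simp: mat_of_rows_list_def)
  have "eigenvalue ?B \<theta> \<longleftrightarrow> \<theta> = 0" for \<theta>
  proof
    assume "eigenvalue ?B \<theta>"
    then obtain v where v: "v \<in> carrier_vec 1" "v \<noteq> 0\<^sub>v 1" "0\<^sub>m 1 1 *\<^sub>v v = \<theta> \<cdot>\<^sub>v v"
      unfolding eigenvalue_def eigenvector_def B by auto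
    have "\<theta> * vec_index v 0 = vec_index (\<theta> \<cdot>\<^sub>v v) 0" using v(1) by simp
    also have "\<dots> = vec_index (0\<^sub>m 1 1 *\<^sub>v v) 0" by (simp only: v(3))
    also have "\<dots> = 0" using v(1) by simp
    finally have "\<theta> * vec_index v 0 = 0" .
    moreover have "vec_index v 0 \<noteq> 0" using v(1,2) by (auto intro!: eq_vecI)
    ultimately show "\<theta> = 0" by simp
  next
    assume "\<theta> = 0"
    then have "eigenvector ?B (vec_of_list [1]) \<theta>"
      unfolding B eigenvector_def by (auto intro!: carrier_vecI eq_vecI simp: vec_eq_iff dest: arg_cong[where f = "\<lambda>v. vec_index v 0"])
    then show "eigenvalue ?B \<theta>" unfolding eigenvalue_def by blast
  qed
  then show ?thesis by blast
qed

text \<open>The equivalence for all F on the vertex type expresses that the intersection array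
  together with the number of vertices characterises the graph. The orderings \<open>ys\<close> and
  \<open>zs\<close> are fixed before the modules are chosen, so the seeds may depend on
  them.\<close>

theorem mainTheorem2:
  fixes E :: "'v::finite rel" and x :: 'v and ys zs :: "'v list"
  assumes "complete_bipartite 3 3 E"
    and "distinct ys" and "set ys = Gam E 1 x"
    and "distinct zs" and "set zs = Gam E 2 x"
  shows "(\<forall>F :: 'v rel. complete_bipartite 3 3 F \<longleftrightarrow>
            distance_regular F \<and> CARD('v) = 6 \<and> intersection_array F = ([3, 2], [1, 3])) \<and>
    spectrum_mult (adj_matrix E) = {(3, 1), (0, 4), (-3, 1)} \<and>
    length ys = 3 \<and> length zs = 2 \<and>
    (\<exists>W\<^sub>0 W\<^sub>1\<^sub>a W\<^sub>1\<^sub>b W\<^sub>2 \<nu>\<^sub>a \<nu>\<^sub>b \<nu>\<^sub>2.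
       let T = terwilliger E x;
           Ws = [W\<^sub>0, W\<^sub>1\<^sub>a, W\<^sub>1\<^sub>b, W\<^sub>2];
           types = [1, 2, 2, 3 :: nat];
           B\<^sub>0 = mat_of_rows_list 3 [[0, 3, 0], [1, 0, 2], [0, 3, 0 :: complex]];
           B\<^sub>1 = mat_of_rows_list 1 [[0 :: complex]]
       in orthogonal_decomposition T Ws \<and>
          (\<forall>i<4. \<forall>j<4. module_isomorphic T (Ws!i) (Ws!j) \<longleftrightarrow> types!i = types!j) \<and>
          has_data E x W\<^sub>0 0 1 3 2 [1, 1, 1] [dual_vec E x 0, dual_vec E x 1, dual_vec E x 2] B\<^sub>0 \<and>
          {\<theta>. eigenvalue B\<^sub>0 \<theta>} = {3, 0, -3} \<and>
          has_data E x W\<^sub>1\<^sub>a 1 2 1 0 [1] [\<nu>\<^sub>a] B\<^sub>1 \<and> is_seed E x W\<^sub>1\<^sub>a ys \<nu>\<^sub>a [1, -1, 0] \<and>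
          has_data E x W\<^sub>1\<^sub>b 1 2 1 0 [1] [\<nu>\<^sub>b] B\<^sub>1 \<and> is_seed E x W\<^sub>1\<^sub>b ys \<nu>\<^sub>b [1, 1, -2] \<and>
          {\<theta>. eigenvalue B\<^sub>1 \<theta>} = {0} \<and>
          has_data E x W\<^sub>2 2 1 1 0 [1] [\<nu>\<^sub>2] B\<^sub>1 \<and> is_seed E x W\<^sub>2 zs \<nu>\<^sub>2 [1, -1] \<and>
          matrix_space_dim T = 3^2 + 1^2 + 1^2 \<and> 3^2 + 1^2 + 1^2 = (11 :: nat))"
proof -
  \<comment> \<open>The two sides play symmetric roles, so they can be named with x in P.\<close>
  have "\<exists>P Q. P \<union> Q = UNIV \<and> P \<inter> Q = {} \<and> card P = 3 \<and> card Q = 3 \<and> E = P \<times> Q \<union> Q \<times> P \<and> x \<in> P"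
  proof -
    from assms(1) obtain P Q where PQ: "P \<union> Q = UNIV" "P \<inter> Q = {}" "card P = 3" "card Q = 3"
        "E = P \<times> Q \<union> Q \<times> P"
      unfolding complete_bipartite_def by blast
    then consider "x \<in> P" | "x \<in> Q" by blast
    then show ?thesis
    proof cases
      case 1
      then show ?thesis using PQ by blast
    next
      case 2
      have "Q \<union> P = UNIV" "Q \<inter> P = {}" "E = Q \<times> P \<union> P \<times> Q" using PQ by blast+
      then show ?thesis using PQ(3,4) 2 by blast
    qed
  qed
  then obtain P Q where PQ: "P \<union> Q = UNIV" "P \<inter> Q = {}" and card: "card P = 3" "card Q = 3"
    and E: "E = P \<times> Q \<union> Q \<times> P" and x: "x \<in> P"
    by blast
  have ne: "P \<noteq> {}" "Q \<noteq> {}" using card by auto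
  note gd = complete_bipartite_gdist(2)[OF PQ ne E]
  have edge: "(x, z) \<in> E \<longleftrightarrow> z \<in> Q" for z using PQ x unfolding E by blast
  have ys: "set ys = Q"
    unfolding assms(3) Gam_def gd edge using x PQ by auto
  have zs: "set zs = P - {x}"
    unfolding assms(5) Gam_def gd edge using x PQ by auto
  have len: "length ys = 3" "length zs = 2"
    using distinct_card[OF assms(2)] distinct_card[OF assms(4)] ys zs card x by simp_all
  \<comment> \<open>The vertex names of the locale come from the given orderings, which is why the
    fixed seeds acquire the prescribed essential parts.\<close>
  obtain q q' q'' where ys_eq: "ys = [q, q', q'']"
    using len(1) by (auto simp: length_Suc_conv numeral_3_eq_3)
  obtain p p' where zs_eq: "zs = [p, p']"
    using len(2) by (auto simp: length_Suc_conv numeral_2_eq_2)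
  have P: "P = {x, p, p'}" and Q: "Q = {q, q', q''}" using ys zs x ys_eq zs_eq by auto
  interpret k33 E x p p' q q' q''
  proof
    show "distinct [x, p, p', q, q', q'']"
      using assms(2,4) zs ys PQ x unfolding ys_eq zs_eq P Q by auto
    show "UNIV = {x, p, p', q, q', q''}" using PQ P Q by auto
    show "E = {x, p, p'} \<times> {q, q', q''} \<union> {q, q', q''} \<times> {x, p, p'}" using E P Q by simp
  qed
  have ess: "essential_part ys \<nu>a = [1, -1, 0]" "essential_part ys \<nu>b = [1, 1, -2]"
    "essential_part zs \<nu>2 = [1, -1]"
    by (simp_all add: essential_part_def ys_eq zs_eq \<nu>a_def \<nu>b_def \<nu>2_def axis_def)
  have "(\<forall>F :: 'v rel. complete_bipartite 3 3 F \<longleftrightarrow>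
      distance_regular F \<and> CARD('v) = 6 \<and> intersection_array F = ([3, 2], [1, 3]))"
    using complete_bipartite_3_3_intersection_array complete_bipartite_3_3I by blast
  have "has_data E x (vec.span {\<nu>a}) 1 2 1 0 [1] [\<nu>a] (mat_of_rows_list 1 [[0]])"
    "has_data E x (vec.span {\<nu>b}) 1 2 1 0 [1] [\<nu>b] (mat_of_rows_list 1 [[0]])"
    "has_data E x (vec.span {\<nu>2}) 2 1 1 0 [1] [\<nu>2] (mat_of_rows_list 1 [[0]])"
    using has_data_seed[OF seeds(1) seeds_nonzero(1) _ decomposition]
      has_data_seed[OF seeds(2) seeds_nonzero(2) _ decomposition]
      has_data_seed[OF seeds(3) seeds_nonzero(3) _ decomposition] dim_seed_1 dim_seed_2
    by simp_all
  have "is_seed E x (vec.span {\<nu>a}) ys \<nu>a [1, -1, 0]"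
    "is_seed E x (vec.span {\<nu>b}) ys \<nu>b [1, 1, -2]" "is_seed E x (vec.span {\<nu>2}) zs \<nu>2 [1, -1]"
    using is_seed_seed[OF seeds(1) seeds_nonzero(1) _ ess(1)]
      is_seed_seed[OF seeds(2) seeds_nonzero(2) _ ess(2)]
      is_seed_seed[OF seeds(3) seeds_nonzero(3) _ ess(3)]
    by simp_all
  have "has_data E x W0 0 1 3 2 [1, 1, 1] [e 0, e 1, e 2]
      (mat_of_rows_list 3 [[0, 3, 0], [1, 0, 2], [0, 3, 0]])"
    using has_data_W0[OF decomposition] by simp
  have "matrix_space_dim T = 3^2 + 1^2 + 1^2" "3^2 + 1^2 + 1^2 = (11 :: nat)"
    using matrix_space_dim_T by simp_all
  have "\<forall>i<4. \<forall>j<4. module_isomorphic T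
      ([W0, vec.span {\<nu>a}, vec.span {\<nu>b}, vec.span {\<nu>2}] ! i)
      ([W0, vec.span {\<nu>a}, vec.span {\<nu>b}, vec.span {\<nu>2}] ! j) \<longleftrightarrow>
      [1, 2, 2, 3 :: nat] ! i = [1, 2, 2, 3] ! j"
    using isomorphic_iff_types by blast
  note * = this decomposition eigenvalues_type_I eigenvalues_type_II
  show ?thesis
    unfolding Let_def
    by (intro conjI, (fact | fact spectrum)+,
        rule exI[of _ W0], rule exI[of _ "vec.span {\<nu>a}"], rule exI[of _ "vec.span {\<nu>b}"],
        rule exI[of _ "vec.span {\<nu>2}"], rule exI[of _ \<nu>a], rule exI[of _ \<nu>b], rule exI[of _ \<nu>2],
        intro conjI, (fact | fact *)+)
qed

end
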